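(* The Ferrers functions ${\rm P}_\nu^\mu={\rm P}_\nu^\mu(z)$, $z\in(-1,1)$, with arbitrary degree $\nu$ and order $\mu$, satisfy the three-term recurrences $$\sqrt{1-z^2}\;{\rm P}_\nu^{\mu+1}+2\mu z\,{\rm P}_\nu^\mu+(\nu+\mu)(\nu-\mu+1)\sqrt{1-z^2}\;{\rm P}_\nu^{\mu-1}=0,$$ $$(\nu-\mu+1)\,{\rm P}_{\nu+1}^\mu-(2\nu+1)z\,{\rm P}_\nu^\mu+(\nu+\mu)\,{\rm P}_{\nu-1}^\mu=0,$$ and the two diagonal recurrences (one for each choice of sign) $$\sqrt{1-z^2}\;{\rm P}_{\nu\pm1}^{\mu+1}+\left[\pm(2\nu+1)(1-z^2)+2\mu\right]{\rm P}_\nu^\mu+\left[(\nu+\tfrac12)\pm(\mu-\tfrac12)\right]\left[(\nu+\tfrac12)\pm(\mu-\tfrac32)\right]\sqrt{1-z^2}\;{\rm P}_{\nu\mp1}^{\mu-1}=0.$$ The second-kind Ferrers functions ${\rm Q}_\nu^\mu$ satisfy identical recurrences. The Legendre functions $P_\nu^\mu(z),Q_\nu^\mu(z)$, $z\in(1,\infty)$ (the latter unnormalized), satisfy the recurrences obtained from the preceding by (i) multiplying each term containing a function of order $\mu+\delta$ and a coefficient proportional to $[\sqrt{1-z^2}]^\alpha$ by the factor ${\rm i}^{\alpha-\delta}$, and (ii) replacing $\sqrt{1-z^2}$ by $\sqrt{z^2-1}$. That is, with $F=P$ or $F=Q$, $$\sqrt{z^2-1}\,F_\nu^{\mu+1}+2\mu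 zF_\nu^\mu-(\nu+\mu)(\nu-\mu+1)\sqrt{z^2-1}\,F_\nu^{\mu-1}=0,$$ $$(\nu-\mu+1)F_{\nu+1}^\mu-(2\nu+1)zF_\nu^\mu+(\nu+\mu)F_{\nu-1}^\mu=0,$$ $$\sqrt{z^2-1}\,F_{\nu\pm1}^{\mu+1}+\left[\mp(2\nu+1)(z^2-1)+2\mu\right]F_\nu^\mu-\left[(\nu+\tfrac12)\pm(\mu-\tfrac12)\right]\left[(\nu+\tfrac12)\pm(\mu-\tfrac32)\right]\sqrt{z^2-1}\,F_{\nu\mp1}^{\mu-1}=0.$$
   Context: For $z\in(-1,1)$, ${\rm P}_\nu^\mu(z)=\frac1{\Gamma(1-\mu)}\left(\frac{1+z}{1-z}\right)^{\mu/2}{}_2F_1\!\left(-\nu,\nu+1;1-\mu;\frac{1-z}2\right)$, and ${\rm Q}_\nu^\mu=\frac\pi2\left[\cot(\mu\pi)\,{\rm P}_\nu^\mu-\csc(\mu\pi)\,\frac{\Gamma(\nu+\mu+1)}{\Gamma(\nu-\mu+1)}\,{\rm P}_\nu^{-\mu}\right]$. For $z>1$, $P_\nu^\mu(z)$ is given by the formula for ${\rm P}_\nu^\mu(z)$ with $1-z$ in the prefactor replaced by $z-1$, and $$Q_\nu^\mu(z)={\rm e}^{\mu\pi{\rm i}}\,\frac{\sqrt\pi}{2^{\nu+1}}\frac{\Gamma(\nu+\mu+1)}{\Gamma(\nu+3/2)}\frac{(z^2-1)^{\mu/2}}{z^{\nu+\mu+1}}\,{}_2F_1\!\left(\tfrac\nu2+\tfrac\mu2+\tfrac12,\tfrac\nu2+\tfrac\mu2+1;\nu+\tfrac32;\tfrac1{z^2}\right).$$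 Here ${}_2F_1$ is the (analytically continued) Gauss function, and limits are taken in exceptional cases (integer $\mu$, or $\nu+\frac32$ a non-positive integer). "Unnormalized" means that the factor ${\rm e}^{\mu\pi{\rm i}}$ is included in $Q_\nu^\mu$. If $\nu+\mu$ is a negative integer, ${\rm Q}_\nu^\mu$ and $Q_\nu^\mu$ are in general undefined; the second-kind recurrences are asserted when the functions involved are defined (and otherwise in a limiting sense). *)

theory Defs
  imports "HOL-Complex_Analysis.Complex_Analysis"
begin

text \<open>The Gauss function, continued analytically from the origin along straight segments, i.e.
  the principal branch. Outside \<open>[1, \<infinity>)\<close> the value exists whenever \<open>c\<close> is not a non-positive
  integer; it is unique by lemma \<open>gauss_2F1_eqI\<close> below.\<close>

definition gauss_2F1 :: "complex \<Rightarrow> complex \<Rightarrow> complex \<Rightarrow> complex \<Rightarrow> complex" where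
  "gauss_2F1 a b c x =
     (THE w. \<exists>S f. open S \<and> x \<in> S \<and> (\<forall>y\<in>S. closed_segment 0 y \<subseteq> S) \<and>
        f holomorphic_on S \<and> f has_fps_expansion fps_hypergeo [a, b] [c] 1 \<and> w = f x)"

lemma gauss_2F1_eqI:
  assumes S: "open S" "x \<in> S" "\<And>y. y \<in> S \<Longrightarrow> closed_segment 0 y \<subseteq> S"
    and f: "f holomorphic_on S" "f has_fps_expansion fps_hypergeo [a, b] [c] 1"
  shows "gauss_2F1 a b c x = f x"
  unfolding gauss_2F1_def
proof (rule the_equality)
  show "\<exists>S g. open S \<and> x \<in> S \<and> (\<forall>y\<in>S. closed_segment 0 y \<subseteq> S) \<and>
        g holomorphic_on S \<and> g has_fps_expansion fps_hypergeo [a, b] [c] 1 \<and> f x = g x"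
    using assms by blast
next
  fix w
  assume "\<exists>T g. open T \<and> x \<in> T \<and> (\<forall>y\<in>T. closed_segment 0 y \<subseteq> T) \<and>
        g holomorphic_on T \<and> g has_fps_expansion fps_hypergeo [a, b] [c] 1 \<and> w = g x"
  then obtain T g where T: "open T" "x \<in> T" "\<And>y. y \<in> T \<Longrightarrow> closed_segment 0 y \<subseteq> T"
    and g: "g holomorphic_on T" "g has_fps_expansion fps_hypergeo [a, b] [c] 1" and w: "w = g x"
    by blast
  let ?U = "S \<inter> T"
  have seg: "closed_segment 0 y \<subseteq> ?U" if "y \<in> ?U" for y
    using that S(3) T(3) by blast
  have 0: "0 \<in> ?U"
    using seg[of x] S(2) T(2) by auto
  have "starlike ?U"
    unfolding starlike_def using 0 seg by blast
  then have conn: "connected ?U"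
    by (rule starlike_imp_connected)
  have "eventually (\<lambda>z. f z = g z) (nhds 0)"
    using f(2) g(2) unfolding has_fps_expansion_def by (auto elim: eventually_elim2)
  then obtain V where V: "open V" "0 \<in> V" "\<And>z. z \<in> V \<Longrightarrow> f z = g z"
    unfolding eventually_nhds by blast
  have "f x = g x"
  proof (rule analytic_continuation_open[of "V \<inter> ?U" ?U f g])
    show "open (V \<inter> ?U)" "open ?U" using V S T by auto
    show "V \<inter> ?U \<noteq> {}" using 0 V(2) by blast
    show "f holomorphic_on ?U" "g holomorphic_on ?U"
      using f(1) g(1) by (auto intro: holomorphic_on_subset)
  qed (use conn V S(2) T(2) in auto)
  with w show "w = f x" by simp
qed

text \<open>In the formulas below the suffix \<open>_raw\<close> marks the expression valid for non-exceptional
  parameters. At a pole \<open>Gamma\<close> is \<open>0\<close> and so is division by it; hence a quotient with a pole of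
  \<open>Gamma\<close> only in the denominator has the intended value \<open>0\<close>.\<close>

definition ferrers_P_raw :: "complex \<Rightarrow> complex \<Rightarrow> real \<Rightarrow> complex" where
  "ferrers_P_raw \<nu> \<mu> z =
     1 / Gamma (1 - \<mu>) * of_real ((1 + z) / (1 - z)) powr (\<mu> / 2) *
     gauss_2F1 (- \<nu>) (\<nu> + 1) (1 - \<mu>) (of_real ((1 - z) / 2))"

definition ferrers_P :: "complex \<Rightarrow> complex \<Rightarrow> real \<Rightarrow> complex" where
  "ferrers_P \<nu> \<mu> z =
     (if 1 - \<mu> \<in> \<int>\<^sub>\<le>\<^sub>0 then Lim (at \<mu>) (\<lambda>m. ferrers_P_raw \<nu> m z) else ferrers_P_raw \<nu> \<mu> z)"

definition ferrers_Q_raw :: "complex \<Rightarrow> complex \<Rightarrow> real \<Rightarrow> complex" where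
  "ferrers_Q_raw \<nu> \<mu> z =
     of_real pi / 2 * (cot (\<mu> * of_real pi) * ferrers_P \<nu> \<mu> z -
       1 / sin (\<mu> * of_real pi) * (Gamma (\<nu> + \<mu> + 1) / Gamma (\<nu> - \<mu> + 1)) * ferrers_P \<nu> (- \<mu>) z)"

definition ferrers_Q :: "complex \<Rightarrow> complex \<Rightarrow> real \<Rightarrow> complex" where
  "ferrers_Q \<nu> \<mu> z =
     (if \<mu> \<in> \<int> then Lim (at \<mu>) (\<lambda>m. ferrers_Q_raw \<nu> m z) else ferrers_Q_raw \<nu> \<mu> z)"

definition legendre_P_raw :: "complex \<Rightarrow> complex \<Rightarrow> real \<Rightarrow> complex" where
  "legendre_P_raw \<nu> \<mu> z =
     1 / Gamma (1 - \<mu>) * of_real ((1 + z) / (z - 1)) powr (\<mu> / 2) *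
     gauss_2F1 (- \<nu>) (\<nu> + 1) (1 - \<mu>) (of_real ((1 - z) / 2))"

definition legendre_P :: "complex \<Rightarrow> complex \<Rightarrow> real \<Rightarrow> complex" where
  "legendre_P \<nu> \<mu> z =
     (if 1 - \<mu> \<in> \<int>\<^sub>\<le>\<^sub>0 then Lim (at \<mu>) (\<lambda>m. legendre_P_raw \<nu> m z) else legendre_P_raw \<nu> \<mu> z)"

definition legendre_Q_raw :: "complex \<Rightarrow> complex \<Rightarrow> real \<Rightarrow> complex" where
  "legendre_Q_raw \<nu> \<mu> z =
     exp (\<mu> * of_real pi * \<i>) * (of_real (sqrt pi) / 2 powr (\<nu> + 1)) *
     (Gamma (\<nu> + \<mu> + 1) / Gamma (\<nu> + 3 / 2)) *
     (of_real (z\<^sup>2 - 1) powr (\<mu> / 2) / of_real z powr (\<nu> + \<mu> + 1)) *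
     gauss_2F1 (\<nu> / 2 + \<mu> / 2 + 1 / 2) (\<nu> / 2 + \<mu> / 2 + 1) (\<nu> + 3 / 2) (of_real (1 / z\<^sup>2))"

definition legendre_Q :: "complex \<Rightarrow> complex \<Rightarrow> real \<Rightarrow> complex" where
  "legendre_Q \<nu> \<mu> z =
     (if \<nu> + 3 / 2 \<in> \<int>\<^sub>\<le>\<^sub>0 then Lim (at \<nu>) (\<lambda>n. legendre_Q_raw n \<mu> z) else legendre_Q_raw \<nu> \<mu> z)"

text \<open>Left-hand sides of the recurrences for a family \<open>F \<nu> \<mu> z\<close>. The diagonal ones carry the sign
  \<open>s = \<plusminus>1\<close>.\<close>

definition ferrers_order_lhs :: "(complex \<Rightarrow> complex \<Rightarrow> real \<Rightarrow> complex) \<Rightarrow> complex \<Rightarrow> complex \<Rightarrow> real \<Rightarrow> complex" where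
  "ferrers_order_lhs F \<nu> \<mu> z =
     of_real (sqrt (1 - z\<^sup>2)) * F \<nu> (\<mu> + 1) z + 2 * \<mu> * of_real z * F \<nu> \<mu> z
     + (\<nu> + \<mu>) * (\<nu> - \<mu> + 1) * of_real (sqrt (1 - z\<^sup>2)) * F \<nu> (\<mu> - 1) z"

definition degree_lhs :: "(complex \<Rightarrow> complex \<Rightarrow> real \<Rightarrow> complex) \<Rightarrow> complex \<Rightarrow> complex \<Rightarrow> real \<Rightarrow> complex" where
  "degree_lhs F \<nu> \<mu> z =
     (\<nu> - \<mu> + 1) * F (\<nu> + 1) \<mu> z - (2 * \<nu> + 1) * of_real z * F \<nu> \<mu> z + (\<nu> + \<mu>) * F (\<nu> - 1) \<mu> z"

definition ferrers_diagonal_lhs ::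
    "complex \<Rightarrow> (complex \<Rightarrow> complex \<Rightarrow> real \<Rightarrow> complex) \<Rightarrow> complex \<Rightarrow> complex \<Rightarrow> real \<Rightarrow> complex" where
  "ferrers_diagonal_lhs s F \<nu> \<mu> z =
     of_real (sqrt (1 - z\<^sup>2)) * F (\<nu> + s) (\<mu> + 1) z
     + (s * (2 * \<nu> + 1) * of_real (1 - z\<^sup>2) + 2 * \<mu>) * F \<nu> \<mu> z
     + ((\<nu> + 1 / 2) + s * (\<mu> - 1 / 2)) * ((\<nu> + 1 / 2) + s * (\<mu> - 3 / 2)) *
       of_real (sqrt (1 - z\<^sup>2)) * F (\<nu> - s) (\<mu> - 1) z"

definition legendre_order_lhs :: "(complex \<Rightarrow> complex \<Rightarrow> real \<Rightarrow> complex) \<Rightarrow> complex \<Rightarrow> complex \<Rightarrow> real \<Rightarrow> complex" where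
  "legendre_order_lhs F \<nu> \<mu> z =
     of_real (sqrt (z\<^sup>2 - 1)) * F \<nu> (\<mu> + 1) z + 2 * \<mu> * of_real z * F \<nu> \<mu> z
     - (\<nu> + \<mu>) * (\<nu> - \<mu> + 1) * of_real (sqrt (z\<^sup>2 - 1)) * F \<nu> (\<mu> - 1) z"

definition legendre_diagonal_lhs ::
    "complex \<Rightarrow> (complex \<Rightarrow> complex \<Rightarrow> real \<Rightarrow> complex) \<Rightarrow> complex \<Rightarrow> complex \<Rightarrow> real \<Rightarrow> complex" where
  "legendre_diagonal_lhs s F \<nu> \<mu> z =
     of_real (sqrt (z\<^sup>2 - 1)) * F (\<nu> + s) (\<mu> + 1) z
     + (- s * (2 * \<nu> + 1) * of_real (z\<^sup>2 - 1) + 2 * \<mu>) * F \<nu> \<mu> z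
     - ((\<nu> + 1 / 2) + s * (\<mu> - 1 / 2)) * ((\<nu> + 1 / 2) + s * (\<mu> - 3 / 2)) *
       of_real (sqrt (z\<^sup>2 - 1)) * F (\<nu> - s) (\<mu> - 1) z"

text \<open>The second-kind functions are defined at degree \<open>\<nu>\<close> and order \<open>\<mu>\<close> unless \<open>\<nu> + \<mu>\<close> is a
  negative integer.\<close>

definition second_kind_defined :: "complex \<Rightarrow> complex \<Rightarrow> bool" where
  "second_kind_defined \<nu> \<mu> \<longleftrightarrow> \<nu> + \<mu> + 1 \<notin> \<int>\<^sub>\<le>\<^sub>0"

text \<open>\<open>second_kind_recurrence a b c d L\<close>: the recurrence with left-hand side \<open>L \<nu> \<mu>\<close>, which involves
  the functions with parameters \<open>(\<nu> + a, \<mu> + b)\<close>, \<open>(\<nu>, \<mu>)\<close> and \<open>(\<nu> + c, \<mu> + d)\<close>, holds exactly where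
  all three are defined, and elsewhere in the limit along parameters for which they are.\<close>

definition second_kind_recurrence ::
    "complex \<Rightarrow> complex \<Rightarrow> complex \<Rightarrow> complex \<Rightarrow> (complex \<Rightarrow> complex \<Rightarrow> complex) \<Rightarrow> complex \<Rightarrow> complex \<Rightarrow> bool" where
  "second_kind_recurrence a b c d L \<nu> \<mu> \<longleftrightarrow>
     (let D = {(n, m). second_kind_defined (n + a) (m + b) \<and> second_kind_defined n m \<and>
                       second_kind_defined (n + c) (m + d)}
      in if (\<nu>, \<mu>) \<in> D then L \<nu> \<mu> = 0
         else ((\<lambda>(n, m). L n m) \<longlongrightarrow> 0) (at (\<nu>, \<mu>) within D))"

end

theory Submission
  imports Defs "HOL-Real_Asymp.Real_Asymp"
begin

text \<open>
  After division by \<open>\<Gamma>(c)\<close> the Gauss series is entire in all its parameters, so limits in exceptional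
  cases become plain evaluations. Four first-order relations (a \<^emph>\<open>ladder\<close>), which express
  \<open>F\<^sub>\<nu>\<^bsup>\<mu>\<plusminus>1\<^esup>\<close> through \<open>F\<^sub>\<nu>\<^bsup>\<mu>\<^esup>\<close> and \<open>F\<^sub>\<nu>\<^sub>\<plusminus>\<^sub>1\<^bsup>\<mu>\<^esup>\<close>, imply all the recurrences by elimination without
  any division by a parameter. For the first kind the ladder is a comparison of power series coefficients;
  it extends to \<open>z > 1\<close> by Pfaff's transformation and the identity theorem. For the second kind the ladder
  is stated for \<open>q = Q / \<Gamma>(\<nu> + \<mu> + 1)\<close>, which is defined for all parameters. In the Ferrers case \<open>q\<close> is a
  quotient by \<open>sin (\<mu>\<pi>)\<close> whose numerator vanishes at integer \<open>\<mu>\<close>, by induction along the ladder.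
\<close>

section \<open>The regularised Gauss series\<close>

text \<open>The obstacle is uniformity in the parameters. At an exceptional point a function is a
  limit in one parameter, whereas a recurrence ties together several parameter pairs, of which only
  some may be exceptional; besides, coefficients such as \<nu> + \<mu> can vanish, so a relation
  must not be solved for a neighbour. With the entire function \<open>rGamma\<close> in place of the
  reciprocal of \<open>Gamma c * pochhammer c n\<close>, each relation is an identity of
  coefficients for all complex \<nu> and \<mu>. Pfaff's transformation is needed because for z > 1
  the argument (1 - z) / 2 lies outside the open unit disc once z \<ge> 3. It always lies in the
  half-plane Re x < 1/2, which x / (x - 1) maps into the disc. For the second kind, the factor
  \<open>Gamma (\<nu> + \<mu> + 1)\<close> has its poles exactly where the functions are undefined.
  The quotient by it therefore lives on all parameters, and the factor returns only where the
  recurrence is evaluated.\<close>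

definition reg_hyp_coeff :: "complex \<Rightarrow> complex \<Rightarrow> complex \<Rightarrow> nat \<Rightarrow> complex" where
  "reg_hyp_coeff a b c n = pochhammer a n * pochhammer b n * rGamma (c + of_nat n) / fact n"

definition reg_hyp :: "complex \<Rightarrow> complex \<Rightarrow> complex \<Rightarrow> complex \<Rightarrow> complex" where
  "reg_hyp a b c x = (\<Sum>n. reg_hyp_coeff a b c n * x ^ n)"

text \<open>Kept free of division, so that it covers c + n = 0 as well: there the left side has a
  zero factor, and on the right \<open>rGamma 0\<close> vanishes.\<close>

lemma reg_hyp_coeff_Suc:
  "(c + of_nat n) * of_nat (Suc n) * reg_hyp_coeff a b c (Suc n) =
     (a + of_nat n) * (b + of_nat n) * reg_hyp_coeff a b c n"
proof -
  have "(c + of_nat n) * rGamma (c + of_nat (Suc n)) = rGamma (c + of_nat n)"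
    using rGamma_plus1[of "c + of_nat n"] by (simp add: add_ac)
  then show ?thesis
    unfolding reg_hyp_coeff_def pochhammer_Suc fact_Suc of_nat_mult
    by (simp add: divide_simps del: of_nat_Suc)
qed

text \<open>A ratio test that is uniform in the parameters: for n > M a term exceeds its predecessor
  by at most the factor (M + n)^2 r / ((n - M) (n + 1)), which tends to r. From some N on it stays
  below a fixed \<rho> < 1, and the majorant is geometric.\<close>

lemma reg_hyp_majorant:
  assumes r: "0 \<le> r" "r < 1"
  obtains B N where "summable B"
    "\<And>n a b c x. \<lbrakk>n \<ge> N; norm a \<le> M; norm b \<le> M; norm c \<le> M; norm x \<le> r\<rbrakk> \<Longrightarrow>
       norm (reg_hyp_coeff a b c n * x ^ n) \<le> B n"
proof -
  obtain \<rho> where \<rho>: "r < \<rho>" "\<rho> < 1" using dense r(2) by blast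
  have "((\<lambda>n. (M + real n) ^ 2 * r / ((real n - M) * (real n + 1))) \<longlonglongrightarrow> r)"
    using r by real_asymp
  then have "\<forall>\<^sub>F n in sequentially. (M + real n) ^ 2 * r / ((real n - M) * (real n + 1)) < \<rho>"
    using \<rho>(1) by (rule order_tendstoD)
  moreover have "\<forall>\<^sub>F n in sequentially. real n > M" by real_asymp
  ultimately have "\<forall>\<^sub>F n in sequentially. real n > M \<and>
      (M + real n) ^ 2 * r \<le> \<rho> * ((real n - M) * (real n + 1))"
    by eventually_elim (subst (asm) pos_divide_less_eq, auto)
  then obtain N where N: "\<And>n. n \<ge> N \<Longrightarrow> real n > M"
      "\<And>n. n \<ge> N \<Longrightarrow> (M + real n) ^ 2 * r \<le> \<rho> * ((real n - M) * (real n + 1))"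
    unfolding eventually_sequentially by blast
  \<comment> \<open>The geometric induction starts at N and needs a bound for the N-th term over all
    admissible parameters. The term is continuous on a compact product of balls, which supplies the
    constant \<open>K\<close>.\<close>
  define f where "f = (\<lambda>(a, b, c, x::complex). reg_hyp_coeff a b c N * x ^ N)"
  let ?K = "cball 0 M \<times> cball 0 M \<times> cball 0 M \<times> cball (0::complex) r"
  have "continuous_on A (\<lambda>x. rGamma (fst (snd (snd x)) + of_nat N))"
    for A :: "(complex \<times> complex \<times> complex \<times> complex) set"
    by (intro continuous_on_compose2[OF holomorphic_on_imp_continuous_on[OF holomorphic_rGamma[of UNIV]]]
        continuous_intros) auto
  then have "compact (f ` ?K)"
    unfolding f_def reg_hyp_coeff_def case_prod_beta
    by (intro compact_continuous_image continuous_intros compact_Times compact_cball) auto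
  then obtain K where K: "\<forall>y\<in>f ` ?K. norm y \<le> K"
    by (auto dest!: compact_imp_bounded simp only: bounded_iff)
  have bound: "norm (reg_hyp_coeff a b c n * x ^ n) \<le> K / \<rho> ^ N * \<rho> ^ n"
    if n: "n \<ge> N" and abc: "norm a \<le> M" "norm b \<le> M" "norm c \<le> M" and x: "norm x \<le> r" for n a b c x
    using n
  proof (induction n rule: dec_induct)
    case base
    have "norm (reg_hyp_coeff a b c N * x ^ N) \<le> K"
      using K[rule_format, OF imageI, of "(a, b, c, x)"] abc x by (simp add: f_def)
    then show ?case using \<rho> r by simp
  next
    case (step n)
    let ?T = "\<lambda>n. norm (reg_hyp_coeff a b c n * x ^ n)"
    have pos: "(real n - M) * (real n + 1) > 0" using N(1)[OF step(1)] by simp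
    have M0: "M \<ge> 0" using norm_ge_zero[of a] abc(1) by linarith
    have "real n - M \<le> norm (c + of_nat n)"
      using norm_triangle_ineq2[of "of_nat n" "- c"] abc by (simp add: add.commute)
    then have "(real n - M) * (real n + 1) * ?T (Suc n) \<le> norm (c + of_nat n) * (real n + 1) * ?T (Suc n)"
      by (intro mult_right_mono) auto
    also have "\<dots> = norm ((c + of_nat n) * of_nat (Suc n) * reg_hyp_coeff a b c (Suc n) * x ^ Suc n)"
      unfolding norm_mult norm_of_nat by simp
    also have "\<dots> = norm (a + of_nat n) * norm (b + of_nat n) * norm x * ?T n"
      unfolding reg_hyp_coeff_Suc by (simp add: norm_mult)
    also have "\<dots> \<le> (M + real n) * (M + real n) * r * ?T n"
      using norm_triangle_ineq[of a "of_nat n"] norm_triangle_ineq[of b "of_nat n"] abc x M0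
      by (intro mult_right_mono mult_mono) auto
    also have "\<dots> \<le> \<rho> * ((real n - M) * (real n + 1)) * ?T n"
      using N(2)[OF step(1)] by (intro mult_right_mono) (auto simp: power2_eq_square)
    also have "\<dots> \<le> \<rho> * ((real n - M) * (real n + 1)) * (K / \<rho> ^ N * \<rho> ^ n)"
      using step pos \<rho> r by (intro mult_left_mono) auto
    finally have "((real n - M) * (real n + 1)) * ?T (Suc n) \<le>
        ((real n - M) * (real n + 1)) * (K / \<rho> ^ N * \<rho> ^ Suc n)"
      by (simp add: mult_ac)
    then show ?case using pos by (simp only: mult_le_cancel_left_pos)
  qed
  have "summable (\<lambda>n. K / \<rho> ^ N * \<rho> ^ n)"
    using \<rho> r by (intro summable_mult summable_geometric) auto
  then show thesis using bound by (rule that)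
qed

lemma reg_hyp_sums:
  assumes "norm x < 1"
  shows "(\<lambda>n. reg_hyp_coeff a b c n * x ^ n) sums reg_hyp a b c x"
proof -
  define M where "M = max (norm a) (max (norm b) (norm c))"
  obtain B N where B: "summable B"
    "\<And>n a b c x'. \<lbrakk>n \<ge> N; norm a \<le> M; norm b \<le> M; norm c \<le> M; norm x' \<le> norm x\<rbrakk> \<Longrightarrow>
       norm (reg_hyp_coeff a b c n * x' ^ n) \<le> B n"
    by (rule reg_hyp_majorant[OF norm_ge_zero assms, of M]) (rule that)
  have "norm (reg_hyp_coeff a b c n * x ^ n) \<le> B n" if "n \<ge> N" for n
    by (rule B(2)[OF that]) (auto simp: M_def)
  then have "summable (\<lambda>n. reg_hyp_coeff a b c n * x ^ n)"
    using B(1) by (blast intro: summable_comparison_test)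
  then show ?thesis unfolding reg_hyp_def by (rule summable_sums)
qed

text \<open>The partial sums are entire in t because \<open>pochhammer\<close> and
  \<open>rGamma\<close> are, and the majorant makes them converge uniformly on every disc. Letting
  all three parameters depend on t serves limits in the order and limits in the degree
  alike.\<close>

lemma holomorphic_reg_hyp_param:
  assumes "a holomorphic_on UNIV" "b holomorphic_on UNIV" "c holomorphic_on UNIV" and x: "norm x < 1"
  shows "(\<lambda>t. reg_hyp (a t) (b t) (c t) x) holomorphic_on UNIV"
proof -
  note cont = assms(1-3)[THEN holomorphic_on_imp_continuous_on]
  let ?f = "\<lambda>t n. reg_hyp_coeff (a t) (b t) (c t) n * x ^ n"
  have "(\<lambda>t. reg_hyp (a t) (b t) (c t) x) holomorphic_on ball t0 1" for t0
  proof -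
    let ?K = "cball t0 1"
    have "compact ((\<lambda>t. (a t, b t, c t)) ` ?K)"
      by (intro compact_continuous_image continuous_intros compact_cball)
        (use cont in \<open>auto intro: continuous_on_subset\<close>)
    then obtain M where M: "\<forall>y\<in>(\<lambda>t. (a t, b t, c t)) ` ?K. norm y \<le> M"
      by (auto dest!: compact_imp_bounded simp only: bounded_iff)
    have M': "norm (a t) \<le> M" "norm (b t) \<le> M" "norm (c t) \<le> M" if "t \<in> ?K" for t
      using M[rule_format, OF imageI, OF that] norm_fst_le[of "a t" "(b t, c t)"] norm_snd_le[of "(b t, c t)" "a t"]
        norm_fst_le[of "b t" "c t"] norm_snd_le[of "c t" "b t"] by auto
    obtain B N where B: "summable B"
      "\<And>n a b c x'. \<lbrakk>n \<ge> N; norm a \<le> M; norm b \<le> M; norm c \<le> M; norm x' \<le> norm x\<rbrakk> \<Longrightarrow>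
         norm (reg_hyp_coeff a b c n * x' ^ n) \<le> B n"
      by (rule reg_hyp_majorant[OF norm_ge_zero x, of M]) (rule that)
    have "uniform_limit ?K (\<lambda>n t. \<Sum>i<n. ?f t i) (\<lambda>t. \<Sum>i. ?f t i) sequentially"
      proof (rule Weierstrass_m_test_ev)
      show "\<forall>\<^sub>F n in sequentially. \<forall>t\<in>?K. norm (?f t n) \<le> B n"
        using B(2) M' by (intro eventually_sequentiallyI[of N] ballI) auto
    qed (rule B(1))
    then have ul: "uniform_limit ?K (\<lambda>n t. \<Sum>i<n. ?f t i) (\<lambda>t. reg_hyp (a t) (b t) (c t) x) sequentially"
      unfolding reg_hyp_def .
    have "(\<lambda>t. \<Sum>i<n. ?f t i) holomorphic_on A" for n A
      unfolding reg_hyp_coeff_def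
      by (intro holomorphic_intros) (use assms in \<open>auto intro: holomorphic_on_subset\<close>)
    then have ev: "\<forall>\<^sub>F n in sequentially. continuous_on ?K (\<lambda>t. \<Sum>i<n. ?f t i) \<and>
        (\<lambda>t. \<Sum>i<n. ?f t i) holomorphic_on ball t0 1"
      by (intro always_eventually allI conjI holomorphic_on_imp_continuous_on)
    show ?thesis
      by (rule holomorphic_uniform_limit[OF ev ul trivial_limit_sequentially])
  qed
  then show ?thesis
    unfolding holomorphic_on_open[OF open_UNIV] holomorphic_on_open[OF open_ball]
    by (meson UNIV_I centre_in_ball zero_less_one)
qed

lemma
  shows holomorphic_reg_hyp: "reg_hyp a b c holomorphic_on ball 0 1"
    and has_fps_expansion_reg_hyp: "reg_hyp a b c has_fps_expansion Abs_fps (reg_hyp_coeff a b c)"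
proof -
  let ?F = "Abs_fps (reg_hyp_coeff a b c)"
  have eq: "eval_fps ?F x = reg_hyp a b c x" for x
    by (simp add: eval_fps_def reg_hyp_def)
  have "fps_conv_radius ?F \<ge> 1"
    unfolding fps_conv_radius_def
  proof (rule conv_radius_geI_ex)
    fix r :: real assume r: "0 < r" "ereal r < 1"
    then show "\<exists>z. norm z = r \<and> summable (\<lambda>n. fps_nth ?F n * z ^ n)"
      using reg_hyp_sums[of "of_real r" a b c] by (intro exI[of _ "of_real r"]) (auto simp: sums_iff)
  qed
  moreover from this have "fps_conv_radius ?F > 0"
    by (rule less_le_trans[rotated]) simp
  moreover have "eval_fps ?F holomorphic_on ball 0 1"
    using calculation(1) by (intro holomorphic_on_eval_fps) (auto simp: eball_def elim: less_le_trans[rotated])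
  ultimately
  show "reg_hyp a b c holomorphic_on ball 0 1"
    "reg_hyp a b c has_fps_expansion ?F"
    using eval_fps_has_fps_expansion[of ?F]
    by (simp_all add: eq[abs_def])
qed

text \<open>Off the poles \<open>Gamma c * rGamma (c + of_nat n)\<close> is
  \<open>1 / pochhammer c n\<close>, so \<open>Gamma c\<close> times the regularised series is the
  Gauss series. The domain is left open in order to fit both the disc and the half-plane.\<close>

lemma gauss_2F1_eq:
  assumes "c \<notin> \<int>\<^sub>\<le>\<^sub>0" and S: "open S" "x \<in> S" "\<And>y. y \<in> S \<Longrightarrow> closed_segment 0 y \<subseteq> S"
    and f: "f holomorphic_on S" "f has_fps_expansion Abs_fps (reg_hyp_coeff a b c)"
  shows "gauss_2F1 a b c x = Gamma c * f x"
proof (rule gauss_2F1_eqI[OF S])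
  show "(\<lambda>x. Gamma c * f x) holomorphic_on S"
    by (intro holomorphic_intros f)
  have "fps_hypergeo [a, b] [c] 1 = fps_const (Gamma c) * Abs_fps (reg_hyp_coeff a b c)"
  proof (rule fps_ext)
    fix n
    have "Gamma c * rGamma (c + of_nat n) = 1 / pochhammer c n"
      using pochhammer_Gamma[OF assms(1), of n] by (simp add: rGamma_inverse_Gamma field_class.field_divide_inverse)
    then show "fps_nth (fps_hypergeo [a, b] [c] 1) n =
        fps_nth (fps_const (Gamma c) * Abs_fps (reg_hyp_coeff a b c)) n"
      by (simp add: reg_hyp_coeff_def field_simps mult.left_commute[of "Gamma c"])
  qed
  then show "(\<lambda>x. Gamma c * f x) has_fps_expansion fps_hypergeo [a, b] [c] 1"
    using has_fps_expansion_cmult_left[OF f(2)] by simp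
qed

lemma gauss_2F1_eq_reg_hyp:
  assumes "c \<notin> \<int>\<^sub>\<le>\<^sub>0" "norm x < 1"
  shows "gauss_2F1 a b c x = Gamma c * reg_hyp a b c x"
proof (rule gauss_2F1_eq[OF assms(1), of "ball 0 1"])
  show "closed_segment 0 y \<subseteq> ball 0 1" if "y \<in> ball 0 1" for y :: complex
    using that by (intro closed_segment_subset) auto
qed (use assms holomorphic_reg_hyp has_fps_expansion_reg_hyp in auto)

section \<open>Pfaff's transformation\<close>

text \<open>Pascal's rule inside a sum. The shifted second part is what allows an induction on
  N.\<close>

lemma sum_binomial_Suc:
  fixes t :: "nat \<Rightarrow> 'a :: comm_ring_1"
  shows "(\<Sum>k\<le>Suc N. of_nat (Suc N choose k) * t k) =
    (\<Sum>k\<le>N. of_nat (N choose k) * t k) + (\<Sum>k\<le>N. of_nat (N choose k) * t (Suc k))"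
proof -
  have "(\<Sum>k\<le>Suc N. of_nat (Suc N choose k) * t k) =
      t 0 + (\<Sum>k\<le>N. of_nat (Suc N choose Suc k) * t (Suc k))"
    by (subst sum.atMost_Suc_shift) simp
  also have "\<dots> = (t 0 + (\<Sum>k\<le>N. of_nat (N choose Suc k) * t (Suc k))) +
      (\<Sum>k\<le>N. of_nat (N choose k) * t (Suc k))"
    by (simp only: binomial_Suc_Suc of_nat_add distrib_right sum.distrib add_ac)
  also have "t 0 + (\<Sum>k\<le>N. of_nat (N choose Suc k) * t (Suc k)) =
      (\<Sum>k\<le>Suc N. of_nat (N choose k) * t k)"
    by (subst sum.atMost_Suc_shift) simp
  also have "\<dots> = (\<Sum>k\<le>N. of_nat (N choose k) * t k)"
    by (simp add: binomial_eq_0)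
  finally show ?thesis .
qed

text \<open>The Chu-Vandermonde sum for 2F1(-N, c - b; c; 1), multiplied by \<open>rGamma c\<close>
  and hence free of exceptions. In the shifted half of Pascal's rule the factor - (c - b) splits off
  and c becomes c + 1 with b unchanged, so the induction needs arbitrary c.\<close>

lemma sum_binomial_pochhammer_rGamma:
  fixes b c :: complex
  shows "(\<Sum>k\<le>N. of_nat (N choose k) * ((-1) ^ k * pochhammer (c - b) k * rGamma (c + of_nat k))) =
     pochhammer b N * rGamma (c + of_nat N)"
proof (induction N arbitrary: c)
  case 0
  then show ?case by simp
next
  case (Suc N)
  let ?t = "\<lambda>c k. (-1) ^ k * pochhammer (c - b) k * rGamma (c + of_nat k)"
  have t_Suc: "?t c (Suc k) = - (c - b) * ?t (c + 1) k" for k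
    by (simp add: pochhammer_rec algebra_simps)
  have "(\<Sum>k\<le>N. of_nat (N choose k) * ?t c (Suc k)) =
      - (c - b) * (\<Sum>k\<le>N. of_nat (N choose k) * ?t (c + 1) k)"
    unfolding t_Suc by (simp add: sum_distrib_left mult_ac)
  also have "\<dots> = - (c - b) * (pochhammer b N * rGamma (c + of_nat (Suc N)))"
    unfolding Suc.IH[of "c + 1"] by (simp add: add_ac)
  finally have "(\<Sum>k\<le>Suc N. of_nat (Suc N choose k) * ?t c k) = pochhammer b N *
      (rGamma (c + of_nat N) - (c - b) * rGamma (c + of_nat (Suc N)))"
    unfolding sum_binomial_Suc Suc.IH[of c] by (simp add: right_diff_distrib left_diff_distrib)
  also have "rGamma (c + of_nat N) = (c + of_nat N) * rGamma (c + of_nat (Suc N))"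
    using rGamma_plus1[of "c + of_nat N"] by (simp add: add_ac)
  also have "pochhammer b N * ((c + of_nat N) * rGamma (c + of_nat (Suc N)) - (c - b) * rGamma (c + of_nat (Suc N))) =
      pochhammer b (Suc N) * rGamma (c + of_nat (Suc N))"
    by (simp add: pochhammer_Suc left_diff_distrib distrib_right del: of_nat_Suc)
  finally show ?case .
qed

lemma fps_binomial_reflect_nth:
  "fps_nth (fps_binomial (- a) oo - fps_X) n = pochhammer a n / fact n" for a :: complex
proof -
  have eq: "- fps_X = fps_const (- 1) * (fps_X :: complex fps)"
    by (simp add: fps_eq_iff)
  show ?thesis
    unfolding eq fps_compose_linear by (simp add: gbinomial_pochhammer)
qed

lemma fps_binomial_reflect_mult:
  "(fps_binomial (- a) oo - fps_X) * (fps_binomial (- b) oo - fps_X) =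
     fps_binomial (- (a + b)) oo - fps_X" for a b :: complex
  by (subst fps_compose_mult_distrib[symmetric]) (simp_all flip: fps_binomial_add_mult)

text \<open>\<open>B a\<close> is the expansion of \<open>(1 - x) powr (- a)\<close>, and \<open>- fps_X * B 1\<close> that of \<open>x / (x - 1)\<close>.\<close>

lemma pfaff_fps:
  fixes a b c :: complex
  defines "B \<equiv> \<lambda>a. fps_binomial (- a) oo - fps_X"
  shows "B a * (Abs_fps (reg_hyp_coeff a (c - b) c) oo (- fps_X * B 1)) = Abs_fps (reg_hyp_coeff a b c)"
proof (rule fps_ext)
  fix N
  define g where "g = - fps_X * B 1"
  define F where "F = Abs_fps (reg_hyp_coeff a (c - b) c)"
  have B_power: "B 1 ^ i = B (of_nat i)" for i
  proof (induction i)
    case 0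
    then show ?case by (simp add: B_def)
  next
    case (Suc i)
    then show ?case by (simp add: B_def fps_binomial_reflect_mult add.commute)
  qed
  have g_power: "g ^ i = fps_const ((- 1) ^ i) * (fps_X ^ i * B (of_nat i))" for i
    unfolding g_def power_mult_distrib B_power power_minus[of fps_X]
    by (simp add: mult_ac flip: fps_const_power fps_const_neg)
  have g_nth: "fps_nth (B a * g ^ i) N =
      (if N < i then 0 else (- 1) ^ i * pochhammer (a + of_nat i) (N - i) / fact (N - i))" for i N
  proof -
    have "B a * g ^ i = fps_const ((- 1) ^ i) * (fps_X ^ i * B (a + of_nat i))"
      unfolding g_power B_def fps_binomial_reflect_mult[symmetric] by (simp only: mult_ac)
    then show ?thesis
      by (simp add: fps_X_power_mult_nth B_def fps_binomial_reflect_nth del: minus_add_distrib)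
  qed
  have "fps_nth (B a * (F oo g)) N =
      (\<Sum>k=0..N. fps_nth (B a) k * (\<Sum>i=0..N-k. fps_nth F i * fps_nth (g ^ i) (N - k)))"
    by (simp add: fps_mult_nth fps_compose_nth)
  \<comment> \<open>\<open>g ^ i\<close> is divisible by \<open>fps_X ^ i\<close>, so the added
    terms with i > N - k vanish. The ranges become independent and the sums can be
    exchanged.\<close>
  also have "\<dots> = (\<Sum>k=0..N. \<Sum>i=0..N. fps_nth F i * (fps_nth (B a) k * fps_nth (g ^ i) (N - k)))"
  proof (rule sum.cong[OF refl])
    fix k
    have "(\<Sum>i=0..N-k. fps_nth F i * fps_nth (g ^ i) (N - k)) =
        (\<Sum>i=0..N. fps_nth F i * fps_nth (g ^ i) (N - k))"
      by (rule sum.mono_neutral_left) (auto simp: g_power fps_X_power_mult_nth)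
    then show "fps_nth (B a) k * (\<Sum>i=0..N-k. fps_nth F i * fps_nth (g ^ i) (N - k)) =
        (\<Sum>i=0..N. fps_nth F i * (fps_nth (B a) k * fps_nth (g ^ i) (N - k)))"
      by (simp add: sum_distrib_left mult_ac)
  qed
  also have "\<dots> = (\<Sum>i=0..N. fps_nth F i * fps_nth (B a * g ^ i) N)"
    by (subst sum.swap) (simp add: fps_mult_nth sum_distrib_left)
  \<comment> \<open>The factors (a)_i from \<open>F\<close> and (a + i)_(N - i) from the binomial
    series combine to (a)_N, independent of i. What remains is the Chu-Vandermonde sum.\<close>
  also have "\<dots> = (\<Sum>i\<le>N. pochhammer a N / fact N *
      (of_nat (N choose i) * ((-1) ^ i * pochhammer (c - b) i * rGamma (c + of_nat i))))"
  proof (rule sum.cong)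
    fix i assume "i \<in> {..N}"
    then have i: "i \<le> N" by simp
    show "fps_nth F i * fps_nth (B a * g ^ i) N = pochhammer a N / fact N *
      (of_nat (N choose i) * ((-1) ^ i * pochhammer (c - b) i * rGamma (c + of_nat i)))"
      using i unfolding g_nth pochhammer_product[OF i, of a] binomial_fact[OF i]
      by (simp add: F_def reg_hyp_coeff_def)
  qed auto
  also have "\<dots> = pochhammer a N / fact N * (pochhammer b N * rGamma (c + of_nat N))"
    by (simp only: sum_binomial_pochhammer_rGamma flip: sum_distrib_left)
  also have "\<dots> = fps_nth (Abs_fps (reg_hyp_coeff a b c)) N"
    by (simp add: reg_hyp_coeff_def)
  finally show "fps_nth (B a * (Abs_fps (reg_hyp_coeff a (c - b) c) oo (- fps_X * B 1))) N =
      fps_nth (Abs_fps (reg_hyp_coeff a b c)) N"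
    unfolding F_def g_def .
qed

text \<open>The right-hand side of Pfaff's transformation, used as the continuation of
  \<open>reg_hyp a b c\<close> to the half-plane Re x < 1/2.\<close>

definition reg_hyp_pfaff :: "complex \<Rightarrow> complex \<Rightarrow> complex \<Rightarrow> complex \<Rightarrow> complex" where
  "reg_hyp_pfaff a b c x = (1 - x) powr (- a) * reg_hyp a (c - b) c (x / (x - 1))"

lemma has_fps_expansion_reg_hyp_pfaff:
  "reg_hyp_pfaff a b c has_fps_expansion Abs_fps (reg_hyp_coeff a b c)"
proof -
  have powr: "(\<lambda>x. (1 - x) powr (- s)) has_fps_expansion (fps_binomial (- s) oo - fps_X)" for s :: complex
    using has_fps_expansion_compose[OF has_fps_expansion_binomial_complex[of "- s"]
        has_fps_expansion_minus[OF has_fps_expansion_fps_X]] by (simp add: o_def)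
  have "(\<lambda>x::complex. - x * (1 - x) powr (- 1)) has_fps_expansion (- fps_X * (fps_binomial (- 1) oo - fps_X))"
    by (intro fps_expansion_intros powr[of 1])
  from has_fps_expansion_mult[OF powr[of a] has_fps_expansion_compose[OF has_fps_expansion_reg_hyp this, of a "c - b" c]]
  have "(\<lambda>x. (1 - x) powr (- a) * reg_hyp a (c - b) c (- x * (1 - x) powr (- 1)))
      has_fps_expansion Abs_fps (reg_hyp_coeff a b c)"
    by (simp only: pfaff_fps o_def) simp
  \<comment> \<open>The formal composition treats x / (x - 1) as - x times a binomial series. The
    two functions agree near 0, and an expansion depends on nothing more.\<close>
  moreover have "\<forall>\<^sub>F x in nhds 0. (1 - x) powr (- a) * reg_hyp a (c - b) c (- x * (1 - x) powr (- 1)) =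
      reg_hyp_pfaff a b c x"
  proof -
    have "\<forall>\<^sub>F x in nhds 0. x \<in> ball (0::complex) 1"
      by (intro eventually_nhds_in_open) auto
    then show ?thesis
    proof eventually_elim
      case (elim x)
      have "- x * inverse (1 - x) = x / (x - 1)"
        by (metis divide_inverse minus_diff_eq minus_divide_left minus_divide_right)
      with elim show ?case
        by (simp add: reg_hyp_pfaff_def powr_minus)
    qed
  qed
  ultimately show ?thesis
    by (rule has_fps_expansion_cong[THEN iffD1, OF _ refl, rotated])
qed

text \<open>Re x < 1/2 says that x is closer to 0 than to 1.\<close>

lemma norm_pfaff_lt_1:
  assumes "Re x < 1 / 2"
  shows "norm (x / (x - 1)) < 1"
proof -
  have "(norm x)\<^sup>2 < (norm (x - 1))\<^sup>2"
    using assms unfolding cmod_power2 by (simp add: power2_eq_square algebra_simps)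
  then have "norm x < norm (x - 1)"
    by (rule power2_less_imp_less) simp
  then show ?thesis
    by (simp add: norm_divide divide_simps)
qed

lemma holomorphic_reg_hyp_pfaff: "reg_hyp_pfaff a b c holomorphic_on {x. Re x < 1 / 2}"
proof -
  have "(reg_hyp a (c - b) c \<circ> (\<lambda>x. x / (x - 1))) holomorphic_on {x. Re x < 1 / 2}"
    by (rule holomorphic_on_compose_gen[OF _ holomorphic_reg_hyp])
      (auto intro!: holomorphic_intros norm_pfaff_lt_1 simp: complex_eq_iff)
  then show ?thesis
    unfolding reg_hyp_pfaff_def[abs_def]
    by (auto intro!: holomorphic_intros simp: o_def complex_nonpos_Reals_iff)
qed

lemma gauss_2F1_eq_reg_hyp_pfaff:
  assumes "c \<notin> \<int>\<^sub>\<le>\<^sub>0" "Re x < 1 / 2"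
  shows "gauss_2F1 a b c x = Gamma c * reg_hyp_pfaff a b c x"
proof (rule gauss_2F1_eq[OF assms(1), of "{x. Re x < 1 / 2}"])
  show "closed_segment 0 y \<subseteq> {x. Re x < 1 / 2}" if "y \<in> {x. Re x < 1 / 2}" for y :: complex
    using that by (intro closed_segment_subset convex_halfspace_Re_lt) auto
qed (use assms in \<open>auto intro: holomorphic_reg_hyp_pfaff has_fps_expansion_reg_hyp_pfaff open_halfspace_Re_lt simp del: less_divide_eq_numeral1\<close>)

section \<open>Contiguous relations\<close>

abbreviation legendre_coeff :: "complex \<Rightarrow> complex \<Rightarrow> nat \<Rightarrow> complex" where
  "legendre_coeff \<nu> \<mu> \<equiv> reg_hyp_coeff (- \<nu>) (\<nu> + 1) (1 - \<mu>)"

text \<open>All coefficients entering the contiguous relations are polynomial multiples of one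
  \<open>K n\<close>, so the relations reduce to polynomial identities. \<open>K\<close> carries
  \<open>rGamma\<close> at the largest argument that occurs, 2 - \<mu> + n: by rGamma s = s rGamma
  (s + 1) the smaller arguments only add factors.\<close>

lemma legendre_coeff_neighbours:
  fixes \<nu> \<mu> :: complex
  obtains K :: "nat \<Rightarrow> complex" where
    "\<And>n. legendre_coeff \<nu> \<mu> (Suc n) = K n * ((of_nat n - \<nu>) * (of_nat n + \<nu> + 1))"
    "\<And>n. legendre_coeff \<nu> \<mu> n = K n * ((of_nat n + 1 - \<mu>) * (of_nat n + 1))"
    "\<And>n. legendre_coeff \<nu> (\<mu> - 1) n = K n * (of_nat n + 1)"
    "\<And>n. legendre_coeff \<nu> (\<mu> + 1) n = K n * ((of_nat n - \<mu>) * (of_nat n + 1 - \<mu>) * (of_nat n + 1))"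
    "\<And>n. legendre_coeff \<nu> (\<mu> + 1) (Suc n) = K n * ((of_nat n + 1 - \<mu>) * (of_nat n - \<nu>) * (of_nat n + \<nu> + 1))"
    "\<And>n. legendre_coeff (\<nu> + 1) \<mu> (Suc n) = - K n * ((of_nat n + \<nu> + 1) * (of_nat n + \<nu> + 2))"
proof -
  let ?K = "\<lambda>n. pochhammer (- \<nu>) n * pochhammer (\<nu> + 1) n * rGamma (2 - \<mu> + of_nat n) / fact (Suc n)"
  have r1: "rGamma (1 - \<mu> + of_nat n) = (of_nat n + 1 - \<mu>) * rGamma (2 - \<mu> + of_nat n)" for n :: nat
    using rGamma_plus1[of "1 - \<mu> + of_nat n"] by (simp add: algebra_simps)
  have r2: "rGamma (- \<mu> + of_nat n) = (of_nat n - \<mu>) * rGamma (1 - \<mu> + of_nat n)" for n :: nat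
    using rGamma_plus1[of "- \<mu> + of_nat n"] by (simp add: algebra_simps)
  have f: "fact (Suc n) = (of_nat n + 1) * (fact n :: complex)" and f0: "of_nat n + 1 \<noteq> (0::complex)" for n :: nat
    by (simp_all add: of_nat_neq_0 add.commute flip: of_nat_Suc)
  have e: "1 - \<mu> + of_nat (Suc n) = 2 - \<mu> + of_nat n" "1 - (\<mu> - 1) + of_nat n = 2 - \<mu> + of_nat n"
    "1 - (\<mu> + 1) + of_nat n = - \<mu> + of_nat n" "1 - (\<mu> + 1) + of_nat (Suc n) = 1 - \<mu> + of_nat n" for n
    by simp_all
  \<comment> \<open>The factor \<nu> + 1 split off the first symbol completes the second one from
    below, which avoids a division by \<nu> + 1.\<close>
  have p: "pochhammer (- (\<nu> + 1)) (Suc n) * pochhammer (\<nu> + 1 + 1) (Suc n) =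
      - (pochhammer (- \<nu>) n * pochhammer (\<nu> + 1) n * ((of_nat n + \<nu> + 1) * (of_nat n + \<nu> + 2)))" for n :: nat
  proof -
    have "pochhammer (- (\<nu> + 1)) (Suc n) = - (\<nu> + 1) * pochhammer (- \<nu>) n"
      using pochhammer_rec[of "- (\<nu> + 1)" n] by simp
    moreover have "(\<nu> + 1) * pochhammer (\<nu> + 1 + 1) (Suc n) =
        pochhammer (\<nu> + 1) n * ((of_nat n + \<nu> + 1) * (of_nat n + \<nu> + 2))"
      using pochhammer_rec[of "\<nu> + 1" "Suc n"] by (simp add: pochhammer_Suc algebra_simps)
    ultimately show ?thesis
      by (metis (no_types, lifting) mult.assoc mult.commute mult.left_commute mult_minus_left)
  qed
  show thesis
  proof (rule that)
    show "legendre_coeff \<nu> \<mu> (Suc n) = ?K n * ((of_nat n - \<nu>) * (of_nat n + \<nu> + 1))" for n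
      unfolding reg_hyp_coeff_def e(1) pochhammer_Suc by (simp add: mult_ac add_ac)
    show "legendre_coeff \<nu> \<mu> n = ?K n * ((of_nat n + 1 - \<mu>) * (of_nat n + 1))" for n
      unfolding reg_hyp_coeff_def r1 f using f0 by simp
    show "legendre_coeff \<nu> (\<mu> - 1) n = ?K n * (of_nat n + 1)" for n
      unfolding reg_hyp_coeff_def e(2) f using f0 by simp
    show "legendre_coeff \<nu> (\<mu> + 1) n = ?K n * ((of_nat n - \<mu>) * (of_nat n + 1 - \<mu>) * (of_nat n + 1))" for n
      unfolding reg_hyp_coeff_def e(3) r2 r1 f using f0 by simp
    show "legendre_coeff \<nu> (\<mu> + 1) (Suc n) = ?K n * ((of_nat n + 1 - \<mu>) * (of_nat n - \<nu>) * (of_nat n + \<nu> + 1))" for n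
      unfolding reg_hyp_coeff_def e(4) r1 pochhammer_Suc by (simp add: mult_ac add_ac)
    show "legendre_coeff (\<nu> + 1) \<mu> (Suc n) = - ?K n * ((of_nat n + \<nu> + 1) * (of_nat n + \<nu> + 2))" for n
      unfolding reg_hyp_coeff_def e(1) p by simp
  qed
qed

lemma fps_X_mult_nth_Suc: "fps_nth (fps_X * F) (Suc n) = fps_nth F n"
  for F :: "'a :: comm_ring_1 fps"
  by simp

text \<open>Stated for any family with the right expansions on a domain containing 0, so that it
  applies to \<open>reg_hyp\<close> on the disc and to \<open>reg_hyp_pfaff\<close> on the
  half-plane. The first relation holds since \<nu> \<mapsto> - \<nu> - 1 merely swaps the two upper
  parameters. In the others 1 - 2 x plays the role of z.\<close>

lemma legendre_ladder:
  assumes \<Phi>: "\<And>\<nu> \<mu>. \<Phi> \<nu> \<mu> has_fps_expansion Abs_fps (legendre_coeff \<nu> \<mu>)"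
    and hol: "\<And>\<nu> \<mu>. \<Phi> \<nu> \<mu> holomorphic_on U"
    and U: "open U" "connected U" "0 \<in> U" "x \<in> U"
  shows "\<Phi> (- \<nu> - 1) \<mu> x = \<Phi> \<nu> \<mu> x"
    and "2 * (1 - x) * \<Phi> \<nu> (\<mu> + 1) x = (\<nu> - \<mu> + 1) * \<Phi> (\<nu> + 1) \<mu> x - (\<nu> + \<mu> + 1) * (1 - 2 * x) * \<Phi> \<nu> \<mu> x"
    and "2 * (\<nu> + \<mu>) * x * \<Phi> \<nu> (\<mu> - 1) x = (1 - 2 * x) * \<Phi> \<nu> \<mu> x - \<Phi> (\<nu> + 1) \<mu> x"
proof -
  let ?F = "\<lambda>\<nu> \<mu>. Abs_fps (legendre_coeff \<nu> \<mu>)"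
  obtain K where coeffs:
    "\<And>n. legendre_coeff \<nu> \<mu> (Suc n) = K n * ((of_nat n - \<nu>) * (of_nat n + \<nu> + 1))"
    "\<And>n. legendre_coeff \<nu> \<mu> n = K n * ((of_nat n + 1 - \<mu>) * (of_nat n + 1))"
    "\<And>n. legendre_coeff \<nu> (\<mu> - 1) n = K n * (of_nat n + 1)"
    "\<And>n. legendre_coeff \<nu> (\<mu> + 1) n = K n * ((of_nat n - \<mu>) * (of_nat n + 1 - \<mu>) * (of_nat n + 1))"
    "\<And>n. legendre_coeff \<nu> (\<mu> + 1) (Suc n) = K n * ((of_nat n + 1 - \<mu>) * (of_nat n - \<nu>) * (of_nat n + \<nu> + 1))"
    "\<And>n. legendre_coeff (\<nu> + 1) \<mu> (Suc n) = - K n * ((of_nat n + \<nu> + 1) * (of_nat n + \<nu> + 2))"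
    by (rule legendre_coeff_neighbours[of \<nu> \<mu>]) (rule that)
  have "?F (- \<nu> - 1) \<mu> = ?F \<nu> \<mu>"
    by (simp add: fps_eq_iff reg_hyp_coeff_def add.commute[of \<nu> 1])
  then have "(\<lambda>x. \<Phi> (- \<nu> - 1) \<mu> x - \<Phi> \<nu> \<mu> x) has_fps_expansion 0"
    using has_fps_expansion_diff[OF \<Phi> \<Phi>, of "- \<nu> - 1" \<mu> \<nu> \<mu>] by simp
  then have "\<Phi> (- \<nu> - 1) \<mu> x - \<Phi> \<nu> \<mu> x = 0"
    by (rule has_fps_expansion_0_analytic_continuation[where A = U]) (intro holomorphic_intros hol U)+
  then show "\<Phi> (- \<nu> - 1) \<mu> x = \<Phi> \<nu> \<mu> x" by simp
  have r: "rGamma (- \<mu>) = - \<mu> * rGamma (1 - \<mu>)"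
    using rGamma_plus1[of "- \<mu>"] by simp
  let ?f = "\<lambda>x. 2 * (\<Phi> \<nu> (\<mu> + 1) x - x * \<Phi> \<nu> (\<mu> + 1) x) -
      ((\<nu> - \<mu> + 1) * \<Phi> (\<nu> + 1) \<mu> x - (\<nu> + \<mu> + 1) * (\<Phi> \<nu> \<mu> x - 2 * (x * \<Phi> \<nu> \<mu> x)))"
  let ?g = "\<lambda>x. 2 * (\<nu> + \<mu>) * (x * \<Phi> \<nu> (\<mu> - 1) x) -
      (\<Phi> \<nu> \<mu> x - 2 * (x * \<Phi> \<nu> \<mu> x) - \<Phi> (\<nu> + 1) \<mu> x)"
  have "?f has_fps_expansion fps_const 2 * (?F \<nu> (\<mu> + 1) - fps_X * ?F \<nu> (\<mu> + 1)) -
      (fps_const (\<nu> - \<mu> + 1) * ?F (\<nu> + 1) \<mu> - fps_const (\<nu> + \<mu> + 1) * (?F \<nu> \<mu> - fps_const 2 * (fps_X * ?F \<nu> \<mu>)))"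
    by (intro fps_expansion_intros \<Phi>)
  also have "\<dots> = 0"
  proof (rule fps_ext)
    fix n
    show "fps_nth (fps_const 2 * (?F \<nu> (\<mu> + 1) - fps_X * ?F \<nu> (\<mu> + 1)) -
      (fps_const (\<nu> - \<mu> + 1) * ?F (\<nu> + 1) \<mu> - fps_const (\<nu> + \<mu> + 1) * (?F \<nu> \<mu> - fps_const 2 * (fps_X * ?F \<nu> \<mu>)))) n =
      fps_nth 0 n"
    proof (cases n)
      case 0
      then show ?thesis by (simp add: reg_hyp_coeff_def r algebra_simps)
    next
      case (Suc m)
      show ?thesis
        unfolding Suc fps_sub_nth fps_mult_left_const_nth fps_X_mult_nth_Suc fps_nth_Abs_fps coeffs[of m] fps_zero_nth by algebra
    qed
  qed
  finally have "?f x = 0"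
    by (rule has_fps_expansion_0_analytic_continuation[where A = U]) (intro holomorphic_intros hol U)+
  then show "2 * (1 - x) * \<Phi> \<nu> (\<mu> + 1) x = (\<nu> - \<mu> + 1) * \<Phi> (\<nu> + 1) \<mu> x - (\<nu> + \<mu> + 1) * (1 - 2 * x) * \<Phi> \<nu> \<mu> x"
    by (simp add: algebra_simps)
  have "?g has_fps_expansion fps_const (2 * (\<nu> + \<mu>)) * (fps_X * ?F \<nu> (\<mu> - 1)) -
      (?F \<nu> \<mu> - fps_const 2 * (fps_X * ?F \<nu> \<mu>) - ?F (\<nu> + 1) \<mu>)"
    by (intro fps_expansion_intros \<Phi>)
  also have "\<dots> = 0"
  proof (rule fps_ext)
    fix n
    show "fps_nth (fps_const (2 * (\<nu> + \<mu>)) * (fps_X * ?F \<nu> (\<mu> - 1)) -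
      (?F \<nu> \<mu> - fps_const 2 * (fps_X * ?F \<nu> \<mu>) - ?F (\<nu> + 1) \<mu>)) n = fps_nth 0 n"
    proof (cases n)
      case 0
      then show ?thesis by (simp add: reg_hyp_coeff_def)
    next
      case (Suc m)
      show ?thesis
        unfolding Suc fps_sub_nth fps_mult_left_const_nth fps_X_mult_nth_Suc fps_nth_Abs_fps coeffs[of m] fps_zero_nth by algebra
    qed
  qed
  finally have "?g x = 0"
    by (rule has_fps_expansion_0_analytic_continuation[where A = U]) (intro holomorphic_intros hol U)+
  then show "2 * (\<nu> + \<mu>) * x * \<Phi> \<nu> (\<mu> - 1) x = (1 - 2 * x) * \<Phi> \<nu> \<mu> x - \<Phi> (\<nu> + 1) \<mu> x"
    by (simp add: algebra_simps)
qed

section \<open>The series in 1 / z^2 for the second kind\<close>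

abbreviation second_coeff :: "complex \<Rightarrow> complex \<Rightarrow> nat \<Rightarrow> complex" where
  "second_coeff \<nu> \<mu> \<equiv> reg_hyp_coeff (\<nu> / 2 + \<mu> / 2 + 1 / 2) (\<nu> / 2 + \<mu> / 2 + 1) (\<nu> + 3 / 2)"

text \<open>Duplication merges the two upper parameters, which differ by 1/2, into one symbol of
  length 2 n. A unit step of \<nu> or \<mu> then shifts its base \<nu> + \<mu> + 1 by an integer
  instead of by halves.\<close>

lemma second_coeff_altdef:
  "second_coeff \<nu> \<mu> n = pochhammer (\<nu> + \<mu> + 1) (2 * n) / 4 ^ n * rGamma (\<nu> + 3 / 2 + of_nat n) / fact n"
proof -
  have "pochhammer (\<nu> + \<mu> + 1) (2 * n) = 4 ^ n *
      (pochhammer (\<nu> / 2 + \<mu> / 2 + 1 / 2) n * pochhammer (\<nu> / 2 + \<mu> / 2 + 1) n)"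
    using pochhammer_double[of "\<nu> / 2 + \<mu> / 2 + 1 / 2" n] by (simp add: power_mult distrib_left add_ac)
  then show ?thesis by (simp add: reg_hyp_coeff_def)
qed

text \<open>Again one common factor: the symbol with base \<nu> + \<mu> + 2 and length 2 n is
  contained in all the symbols that occur, and \<nu> + 5/2 + n is the largest argument of
  \<open>rGamma\<close>.\<close>

lemma second_coeff_neighbours:
  fixes \<nu> \<mu> :: complex
  obtains K :: "nat \<Rightarrow> complex" where
    "\<And>n. second_coeff \<nu> \<mu> (Suc n) = K n * ((\<nu> + \<mu> + 1) * (\<nu> + \<mu> + 2 * of_nat n + 2))"
    "\<And>n. second_coeff \<nu> (\<mu> + 1) (Suc n) = K n * ((\<nu> + \<mu> + 2 * of_nat n + 2) * (\<nu> + \<mu> + 2 * of_nat n + 3))"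
    "\<And>n. second_coeff \<nu> (\<mu> + 1) n = K n * (4 * (of_nat n + 1) * (\<nu> + 3 / 2 + of_nat n))"
    "\<And>n. second_coeff (\<nu> + 1) \<mu> n = K n * (4 * (of_nat n + 1))"
    "\<And>n. second_coeff \<nu> (\<mu> - 1) (Suc n) = K n * ((\<nu> + \<mu>) * (\<nu> + \<mu> + 1))"
    "\<And>n. second_coeff (\<nu> - 1) \<mu> (Suc n) = K n * ((\<nu> + \<mu>) * (\<nu> + \<mu> + 1) * (\<nu> + 3 / 2 + of_nat n))"
proof -
  let ?K = "\<lambda>n. pochhammer (\<nu> + \<mu> + 2) (2 * n) * rGamma (\<nu> + 5 / 2 + of_nat n) / (4 ^ Suc n * fact (Suc n))"
  define s where "s = \<nu> + \<mu>"
  have r: "rGamma (\<nu> + 3 / 2 + of_nat n) = (\<nu> + 3 / 2 + of_nat n) * rGamma (\<nu> + 5 / 2 + of_nat n)" for n :: nat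
    using rGamma_plus1[of "\<nu> + 3 / 2 + of_nat n"] by (simp add: algebra_simps)
  have f: "fact (Suc n) = (of_nat n + 1) * (fact n :: complex)" and f0: "of_nat n + 1 \<noteq> (0::complex)" for n :: nat
    by (simp_all add: of_nat_neq_0 add.commute flip: of_nat_Suc)
  have e: "\<nu> + 3 / 2 + of_nat (Suc n) = \<nu> + 5 / 2 + of_nat n" "\<nu> + 1 + 3 / 2 + of_nat n = \<nu> + 5 / 2 + of_nat n"
    "\<nu> - 1 + 3 / 2 + of_nat (Suc n) = \<nu> + 3 / 2 + of_nat n"
    "\<nu> + (\<mu> + 1) + 1 = s + 2" "\<nu> + 1 + \<mu> + 1 = s + 2" "\<nu> + (\<mu> - 1) + 1 = s" "\<nu> - 1 + \<mu> + 1 = s"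
    "\<nu> + \<mu> + 2 = s + 2" "\<nu> + \<mu> + 1 = s + 1" for n
    by (simp_all add: s_def)
  have p0: "pochhammer s (2 * Suc n) = s * (s + 1) * pochhammer (s + 2) (2 * n)" for n :: nat
    using pochhammer_rec[of s "Suc (2 * n)"] pochhammer_rec[of "s + 1" "2 * n"] by (simp add: add.assoc)
  have p1: "pochhammer (s + 1) (2 * Suc n) = (s + 1) * (s + 2 * of_nat n + 2) * pochhammer (s + 2) (2 * n)" for n :: nat
    using pochhammer_rec[of "s + 1" "Suc (2 * n)"] pochhammer_rec'[of "s + 2" "2 * n"]
    by (simp add: algebra_simps)
  have p2: "pochhammer (s + 2) (2 * Suc n) = (s + 2 * of_nat n + 2) * (s + 2 * of_nat n + 3) * pochhammer (s + 2) (2 * n)" for n :: nat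
    using pochhammer_rec'[of "s + 2" "Suc (2 * n)"] pochhammer_rec'[of "s + 2" "2 * n"]
    by (simp add: algebra_simps)
  note unf = second_coeff_altdef e p0 p1 p2 r s_def[symmetric]
  show thesis
  proof (rule that)
    show "second_coeff \<nu> \<mu> (Suc n) = ?K n * ((\<nu> + \<mu> + 1) * (\<nu> + \<mu> + 2 * of_nat n + 2))" for n
      unfolding unf by (simp add: mult_ac)
    show "second_coeff \<nu> (\<mu> + 1) (Suc n) = ?K n * ((\<nu> + \<mu> + 2 * of_nat n + 2) * (\<nu> + \<mu> + 2 * of_nat n + 3))" for n
      unfolding unf by (simp add: mult_ac)
    show "second_coeff \<nu> (\<mu> + 1) n = ?K n * (4 * (of_nat n + 1) * (\<nu> + 3 / 2 + of_nat n))" for n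
      unfolding unf f using f0 by (simp del: distrib_left_numeral)
    show "second_coeff (\<nu> + 1) \<mu> n = ?K n * (4 * (of_nat n + 1))" for n
      unfolding unf f using f0 by (simp del: distrib_left_numeral)
    show "second_coeff \<nu> (\<mu> - 1) (Suc n) = ?K n * ((\<nu> + \<mu>) * (\<nu> + \<mu> + 1))" for n
      unfolding unf by (simp add: mult_ac)
    show "second_coeff (\<nu> - 1) \<mu> (Suc n) = ?K n * ((\<nu> + \<mu>) * (\<nu> + \<mu> + 1) * (\<nu> + 3 / 2 + of_nat n))" for n
      unfolding unf by (simp add: mult_ac)
  qed
qed

abbreviation second_hyp :: "complex \<Rightarrow> complex \<Rightarrow> complex \<Rightarrow> complex" where
  "second_hyp \<nu> \<mu> \<equiv> reg_hyp (\<nu> / 2 + \<mu> / 2 + 1 / 2) (\<nu> / 2 + \<mu> / 2 + 1) (\<nu> + 3 / 2)"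

lemma fps_eq_0I:
  assumes "fps_nth F 0 = 0" "\<And>n. fps_nth F (Suc n) = 0"
  shows "F = 0"
  using assms by (intro fps_ext) (metis fps_zero_nth not0_implies_Suc)

text \<open>Here \<nu> \<mapsto> - \<nu> - 1 is not a symmetry, as it changes the lower parameter
  \<nu> + 3/2. So all four rungs are compared coefficientwise.\<close>

lemma second_hyp_ladder:
  assumes y: "norm y < 1"
  shows "(1 - y) * second_hyp \<nu> (\<mu> + 1) y = second_hyp \<nu> \<mu> y - (\<nu> - \<mu> + 1) / 2 * y * second_hyp (\<nu> + 1) \<mu> y"
    and "(\<nu> + \<mu> + 1) * (1 - y) * second_hyp \<nu> (\<mu> + 1) y = 2 * second_hyp (\<nu> - 1) \<mu> y - (\<nu> - \<mu>) * second_hyp \<nu> \<mu> y"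
    and "second_hyp \<nu> (\<mu> - 1) y = second_hyp \<nu> \<mu> y - (\<nu> + \<mu> + 1) / 2 * y * second_hyp (\<nu> + 1) \<mu> y"
    and "(\<nu> - \<mu> + 1) * second_hyp \<nu> (\<mu> - 1) y = 2 * second_hyp (\<nu> - 1) \<mu> y - (\<nu> + \<mu>) * second_hyp \<nu> \<mu> y"
proof -
  let ?F = "\<lambda>\<nu> \<mu>. Abs_fps (second_coeff \<nu> \<mu>)"
  obtain K where coeffs:
    "\<And>n. second_coeff \<nu> \<mu> (Suc n) = K n * ((\<nu> + \<mu> + 1) * (\<nu> + \<mu> + 2 * of_nat n + 2))"
    "\<And>n. second_coeff \<nu> (\<mu> + 1) (Suc n) = K n * ((\<nu> + \<mu> + 2 * of_nat n + 2) * (\<nu> + \<mu> + 2 * of_nat n + 3))"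
    "\<And>n. second_coeff \<nu> (\<mu> + 1) n = K n * (4 * (of_nat n + 1) * (\<nu> + 3 / 2 + of_nat n))"
    "\<And>n. second_coeff (\<nu> + 1) \<mu> n = K n * (4 * (of_nat n + 1))"
    "\<And>n. second_coeff \<nu> (\<mu> - 1) (Suc n) = K n * ((\<nu> + \<mu>) * (\<nu> + \<mu> + 1))"
    "\<And>n. second_coeff (\<nu> - 1) \<mu> (Suc n) = K n * ((\<nu> + \<mu>) * (\<nu> + \<mu> + 1) * (\<nu> + 3 / 2 + of_nat n))"
    by (rule second_coeff_neighbours[of \<nu> \<mu>]) (rule that)
  note nths = fps_sub_nth fps_mult_left_const_nth fps_X_mult_nth_Suc fps_nth_Abs_fps
  \<comment> \<open>Needed for the constant terms, which \<open>coeffs\<close> does not relate: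
    lowering the degree lowers the argument of \<open>rGamma\<close> to \<nu> + 1/2.\<close>
  have r: "rGamma (\<nu> + 1 / 2) = (\<nu> + 1 / 2) * rGamma (\<nu> + 3 / 2)"
    using rGamma_plus1[of "\<nu> + 1 / 2"] by (simp add: add.assoc)
  have zero: "f y = 0" if "f has_fps_expansion F" "F = 0" "f holomorphic_on ball 0 1" for f F
    using that has_fps_expansion_0_analytic_continuation[of f "ball 0 1" y] y by simp
  note intros = fps_expansion_intros holomorphic_intros holomorphic_reg_hyp has_fps_expansion_reg_hyp
  let ?f1 = "\<lambda>y. second_hyp \<nu> (\<mu> + 1) y - y * second_hyp \<nu> (\<mu> + 1) y -
      (second_hyp \<nu> \<mu> y - (\<nu> - \<mu> + 1) / 2 * (y * second_hyp (\<nu> + 1) \<mu> y))"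
  let ?F1 = "?F \<nu> (\<mu> + 1) - fps_X * ?F \<nu> (\<mu> + 1) -
      (?F \<nu> \<mu> - fps_const ((\<nu> - \<mu> + 1) / 2) * (fps_X * ?F (\<nu> + 1) \<mu>))"
  have "?F1 = 0"
  proof (rule fps_eq_0I)
    show "fps_nth ?F1 0 = 0" by (simp add: reg_hyp_coeff_def)
    show "fps_nth ?F1 (Suc n) = 0" for n
      unfolding nths coeffs[of n] by (simp add: field_simps)
  qed
  then have "?f1 y = 0" by (intro zero[of _ ?F1] intros)
  then show "(1 - y) * second_hyp \<nu> (\<mu> + 1) y = second_hyp \<nu> \<mu> y - (\<nu> - \<mu> + 1) / 2 * y * second_hyp (\<nu> + 1) \<mu> y"
    by (simp add: algebra_simps)
  let ?f2 = "\<lambda>y. (\<nu> + \<mu> + 1) * (second_hyp \<nu> (\<mu> + 1) y - y * second_hyp \<nu> (\<mu> + 1) y) -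
      (2 * second_hyp (\<nu> - 1) \<mu> y - (\<nu> - \<mu>) * second_hyp \<nu> \<mu> y)"
  let ?F2 = "fps_const (\<nu> + \<mu> + 1) * (?F \<nu> (\<mu> + 1) - fps_X * ?F \<nu> (\<mu> + 1)) -
      (fps_const 2 * ?F (\<nu> - 1) \<mu> - fps_const (\<nu> - \<mu>) * ?F \<nu> \<mu>)"
  have "?F2 = 0"
  proof (rule fps_eq_0I)
    show "fps_nth ?F2 0 = 0" by (simp add: reg_hyp_coeff_def r algebra_simps)
    show "fps_nth ?F2 (Suc n) = 0" for n
      unfolding nths coeffs[of n] by (simp add: field_simps)
  qed
  then have "?f2 y = 0" by (intro zero[of _ ?F2] intros)
  then show "(\<nu> + \<mu> + 1) * (1 - y) * second_hyp \<nu> (\<mu> + 1) y = 2 * second_hyp (\<nu> - 1) \<mu> y - (\<nu> - \<mu>) * second_hyp \<nu> \<mu> y"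
    by (simp add: algebra_simps)
  let ?f3 = "\<lambda>y. second_hyp \<nu> (\<mu> - 1) y - (second_hyp \<nu> \<mu> y - (\<nu> + \<mu> + 1) / 2 * (y * second_hyp (\<nu> + 1) \<mu> y))"
  let ?F3 = "?F \<nu> (\<mu> - 1) - (?F \<nu> \<mu> - fps_const ((\<nu> + \<mu> + 1) / 2) * (fps_X * ?F (\<nu> + 1) \<mu>))"
  have "?F3 = 0"
  proof (rule fps_eq_0I)
    show "fps_nth ?F3 0 = 0" by (simp add: reg_hyp_coeff_def)
    show "fps_nth ?F3 (Suc n) = 0" for n
      unfolding nths coeffs[of n] by (simp add: field_simps)
  qed
  then have "?f3 y = 0" by (intro zero[of _ ?F3] intros)
  then show "second_hyp \<nu> (\<mu> - 1) y = second_hyp \<nu> \<mu> y - (\<nu> + \<mu> + 1) / 2 * y * second_hyp (\<nu> + 1) \<mu> y"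
    by (simp add: algebra_simps)
  let ?f4 = "\<lambda>y. (\<nu> - \<mu> + 1) * second_hyp \<nu> (\<mu> - 1) y - (2 * second_hyp (\<nu> - 1) \<mu> y - (\<nu> + \<mu>) * second_hyp \<nu> \<mu> y)"
  let ?F4 = "fps_const (\<nu> - \<mu> + 1) * ?F \<nu> (\<mu> - 1) -
      (fps_const 2 * ?F (\<nu> - 1) \<mu> - fps_const (\<nu> + \<mu>) * ?F \<nu> \<mu>)"
  have "?F4 = 0"
  proof (rule fps_eq_0I)
    show "fps_nth ?F4 0 = 0" by (simp add: reg_hyp_coeff_def r algebra_simps)
    show "fps_nth ?F4 (Suc n) = 0" for n
      unfolding nths coeffs[of n] by (simp add: field_simps)
  qed
  then have "?f4 y = 0" by (intro zero[of _ ?F4] intros)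
  then show "(\<nu> - \<mu> + 1) * second_hyp \<nu> (\<mu> - 1) y = 2 * second_hyp (\<nu> - 1) \<mu> y - (\<nu> + \<mu>) * second_hyp \<nu> \<mu> y"
    by (simp add: algebra_simps)
qed

section \<open>From ladders to recurrences\<close>

text \<open>Here \<open>w\<^sup>2 = \<sigma> (1 - z\<^sup>2)\<close>, with \<open>\<sigma> = 1\<close> for Ferrers functions and \<open>\<sigma> = -1\<close> for \<open>z > 1\<close>.\<close>

definition ladder :: "complex \<Rightarrow> complex \<Rightarrow> complex \<Rightarrow> (complex \<Rightarrow> complex \<Rightarrow> complex) \<Rightarrow> bool" where
  "ladder \<sigma> w z F \<longleftrightarrow> (\<forall>\<nu> \<mu>.
     w * F \<nu> (\<mu> + 1) = (\<nu> - \<mu> + 1) * F (\<nu> + 1) \<mu> - (\<nu> + \<mu> + 1) * z * F \<nu> \<mu> \<and>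
     w * F \<nu> (\<mu> + 1) = (\<nu> - \<mu>) * z * F \<nu> \<mu> - (\<nu> + \<mu>) * F (\<nu> - 1) \<mu> \<and>
     \<sigma> * (\<nu> + \<mu>) * w * F \<nu> (\<mu> - 1) = z * F \<nu> \<mu> - F (\<nu> + 1) \<mu> \<and>
     \<sigma> * (\<nu> - \<mu> + 1) * w * F \<nu> (\<mu> - 1) = F (\<nu> - 1) \<mu> - z * F \<nu> \<mu>)"

text \<open>The ladder satisfied by \<open>F / \<Gamma>(\<nu> + \<mu> + 1)\<close>.\<close>

definition reg_ladder :: "complex \<Rightarrow> complex \<Rightarrow> complex \<Rightarrow> (complex \<Rightarrow> complex \<Rightarrow> complex) \<Rightarrow> bool" where
  "reg_ladder \<sigma> w z q \<longleftrightarrow> (\<forall>\<nu> \<mu>.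
     w * q \<nu> (\<mu> + 1) = (\<nu> - \<mu> + 1) * q (\<nu> + 1) \<mu> - z * q \<nu> \<mu> \<and>
     (\<nu> + \<mu> + 1) * w * q \<nu> (\<mu> + 1) = (\<nu> - \<mu>) * z * q \<nu> \<mu> - q (\<nu> - 1) \<mu> \<and>
     \<sigma> * w * q \<nu> (\<mu> - 1) = z * q \<nu> \<mu> - (\<nu> + \<mu> + 1) * q (\<nu> + 1) \<mu> \<and>
     \<sigma> * (\<nu> - \<mu> + 1) * w * q \<nu> (\<mu> - 1) = q (\<nu> - 1) \<mu> - (\<nu> + \<mu>) * z * q \<nu> \<mu>)"

text \<open>The rule of multiplying by i^(\<alpha> - \<delta>) changes the sign of the term of order
  \<mu> - 1 only, hence the single \<sigma>. In the diagonal recurrence the coefficient with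
  \<alpha> = 2 and \<delta> = 0 becomes - (z^2 - 1), which is 1 - z^2 again.\<close>

definition order_rec :: "complex \<Rightarrow> complex \<Rightarrow> complex \<Rightarrow> (complex \<Rightarrow> complex \<Rightarrow> complex) \<Rightarrow> complex \<Rightarrow> complex \<Rightarrow> complex" where
  "order_rec \<sigma> w z F \<nu> \<mu> =
     w * F \<nu> (\<mu> + 1) + 2 * \<mu> * z * F \<nu> \<mu> + \<sigma> * ((\<nu> + \<mu>) * (\<nu> - \<mu> + 1) * w * F \<nu> (\<mu> - 1))"

definition degree_rec :: "complex \<Rightarrow> (complex \<Rightarrow> complex \<Rightarrow> complex) \<Rightarrow> complex \<Rightarrow> complex \<Rightarrow> complex" where
  "degree_rec z F \<nu> \<mu> = (\<nu> - \<mu> + 1) * F (\<nu> + 1) \<mu> - (2 * \<nu> + 1) * z * F \<nu> \<mu> + (\<nu> + \<mu>) * F (\<nu> - 1) \<mu>"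

definition diagonal_rec ::
    "complex \<Rightarrow> complex \<Rightarrow> complex \<Rightarrow> complex \<Rightarrow> (complex \<Rightarrow> complex \<Rightarrow> complex) \<Rightarrow> complex \<Rightarrow> complex \<Rightarrow> complex" where
  "diagonal_rec s \<sigma> w z F \<nu> \<mu> =
     w * F (\<nu> + s) (\<mu> + 1) + (s * (2 * \<nu> + 1) * (1 - z\<^sup>2) + 2 * \<mu>) * F \<nu> \<mu>
     + \<sigma> * (((\<nu> + 1 / 2) + s * (\<mu> - 1 / 2)) * ((\<nu> + 1 / 2) + s * (\<mu> - 3 / 2)) * w * F (\<nu> - s) (\<mu> - 1))"

lemma ladderD:
  assumes "ladder \<sigma> w z F"
  shows "w * F \<nu> (\<mu> + 1) = (\<nu> - \<mu> + 1) * F (\<nu> + 1) \<mu> - (\<nu> + \<mu> + 1) * z * F \<nu> \<mu>"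
    and "w * F \<nu> (\<mu> + 1) = (\<nu> - \<mu>) * z * F \<nu> \<mu> - (\<nu> + \<mu>) * F (\<nu> - 1) \<mu>"
    and "\<sigma> * (\<nu> + \<mu>) * w * F \<nu> (\<mu> - 1) = z * F \<nu> \<mu> - F (\<nu> + 1) \<mu>"
    and "\<sigma> * (\<nu> - \<mu> + 1) * w * F \<nu> (\<mu> - 1) = F (\<nu> - 1) \<mu> - z * F \<nu> \<mu>"
  using assms unfolding ladder_def by blast+

lemma reg_ladderD:
  assumes "reg_ladder \<sigma> w z q"
  shows "w * q \<nu> (\<mu> + 1) = (\<nu> - \<mu> + 1) * q (\<nu> + 1) \<mu> - z * q \<nu> \<mu>"
    and "(\<nu> + \<mu> + 1) * w * q \<nu> (\<mu> + 1) = (\<nu> - \<mu>) * z * q \<nu> \<mu> - q (\<nu> - 1) \<mu>"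
    and "\<sigma> * w * q \<nu> (\<mu> - 1) = z * q \<nu> \<mu> - (\<nu> + \<mu> + 1) * q (\<nu> + 1) \<mu>"
    and "\<sigma> * (\<nu> - \<mu> + 1) * w * q \<nu> (\<mu> - 1) = q (\<nu> - 1) \<mu> - (\<nu> + \<mu>) * z * q \<nu> \<mu>"
  using assms unfolding reg_ladder_def by blast+

text \<open>The second rung plus \<nu> + \<mu> times the fourth is the order recurrence. Equating
  the two expressions for w F of order \<mu> + 1 gives the degree recurrence.\<close>

lemma ladder_recurrences:
  assumes "ladder \<sigma> w z F"
  shows "order_rec \<sigma> w z F \<nu> \<mu> = 0" and "degree_rec z F \<nu> \<mu> = 0"
    and "s \<in> {1, - 1} \<Longrightarrow> diagonal_rec s \<sigma> w z F \<nu> \<mu> = 0"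
proof -
  note L = ladderD[OF assms]
  show "order_rec \<sigma> w z F \<nu> \<mu> = 0"
    using L[of \<nu> \<mu>] unfolding order_rec_def by algebra
  show deg: "degree_rec z F \<nu> \<mu> = 0"
    using L[of \<nu> \<mu>] unfolding degree_rec_def by algebra
  \<comment> \<open>Rungs based at \<nu> + 1 and \<nu> - 1 replace the outer terms by functions of
    order \<mu>. Substituted into the diagonal recurrence they leave z times the degree recurrence;
    for the other sign, - z times it.\<close>
  have "w * F (\<nu> + 1) (\<mu> + 1) = (\<nu> + 1 - \<mu>) * z * F (\<nu> + 1) \<mu> - (\<nu> + 1 + \<mu>) * F \<nu> \<mu>"
    "\<sigma> * (\<nu> - 1 + \<mu>) * w * F (\<nu> - 1) (\<mu> - 1) = z * F (\<nu> - 1) \<mu> - F \<nu> \<mu>"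
    using L(2)[of "\<nu> + 1" \<mu>] L(3)[of "\<nu> - 1" \<mu>] by simp_all
  with deg have "w * F (\<nu> + 1) (\<mu> + 1) + ((2 * \<nu> + 1) * (1 - z\<^sup>2) + 2 * \<mu>) * F \<nu> \<mu>
      + \<sigma> * ((\<nu> + \<mu>) * (\<nu> + \<mu> - 1) * w * F (\<nu> - 1) (\<mu> - 1)) = 0"
    unfolding degree_rec_def by algebra
  then have 1: "diagonal_rec 1 \<sigma> w z F \<nu> \<mu> = 0"
    by (simp add: diagonal_rec_def algebra_simps)
  have "w * F (\<nu> - 1) (\<mu> + 1) = (\<nu> - 1 - \<mu> + 1) * F \<nu> \<mu> - (\<nu> - 1 + \<mu> + 1) * z * F (\<nu> - 1) \<mu>"
    "\<sigma> * (\<nu> + 1 - \<mu> + 1) * w * F (\<nu> + 1) (\<mu> - 1) = F \<nu> \<mu> - z * F (\<nu> + 1) \<mu>"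
    using L(1)[of "\<nu> - 1" \<mu>] L(4)[of "\<nu> + 1" \<mu>] by simp_all
  with deg have "w * F (\<nu> - 1) (\<mu> + 1) + (- (2 * \<nu> + 1) * (1 - z\<^sup>2) + 2 * \<mu>) * F \<nu> \<mu>
      + \<sigma> * ((\<nu> - \<mu> + 1) * (\<nu> - \<mu> + 2) * w * F (\<nu> + 1) (\<mu> - 1)) = 0"
    unfolding degree_rec_def by algebra
  then have 2: "diagonal_rec (- 1) \<sigma> w z F \<nu> \<mu> = 0"
    by (simp add: diagonal_rec_def algebra_simps)
  show "diagonal_rec s \<sigma> w z F \<nu> \<mu> = 0" if "s \<in> {1, - 1}"
    using that 1 2 by blast
qed

text \<open>If the left-hand side is zero throughout the set of admissible parameters, the limit
  along that set is the limit of a function constantly 0 there.\<close>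

lemma second_kind_recurrenceI:
  assumes "\<And>n m. second_kind_defined (n + a) (m + b) \<Longrightarrow> second_kind_defined n m \<Longrightarrow>
      second_kind_defined (n + c) (m + d) \<Longrightarrow> L n m = 0"
  shows "second_kind_recurrence a b c d L \<nu> \<mu>"
proof -
  define D where "D = {(n, m). second_kind_defined (n + a) (m + b) \<and> second_kind_defined n m \<and>
      second_kind_defined (n + c) (m + d)}"
  have D: "L n m = 0" if "(n, m) \<in> D" for n m
    using that assms by (auto simp: D_def)
  have "\<forall>\<^sub>F p in at (\<nu>, \<mu>) within D. (\<lambda>(n, m). L n m) p = 0"
    unfolding eventually_at_filter by (rule always_eventually) (auto intro: D)
  then have "((\<lambda>(n, m). L n m) \<longlongrightarrow> 0) (at (\<nu>, \<mu>) within D)"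
    by (rule tendsto_eventually)
  with D show ?thesis
    unfolding second_kind_recurrence_def D_def[symmetric] Let_def by simp
qed

lemma reg_ladder_recurrences:
  assumes "reg_ladder \<sigma> w z q"
    and F: "\<And>\<nu> \<mu>. second_kind_defined \<nu> \<mu> \<Longrightarrow> F \<nu> \<mu> = Gamma (\<nu> + \<mu> + 1) * q \<nu> \<mu>"
  shows "second_kind_recurrence 0 1 0 (- 1) (order_rec \<sigma> w z F) \<nu> \<mu>"
    and "second_kind_recurrence 1 0 (- 1) 0 (degree_rec z F) \<nu> \<mu>"
    and "s \<in> {1, - 1} \<Longrightarrow> second_kind_recurrence s 1 (- s) (- 1) (diagonal_rec s \<sigma> w z F) \<nu> \<mu>"
proof -
  note L = reg_ladderD[OF assms(1)]
  \<comment> \<open>The first rung times n + m + 1 and the second rung have the same left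
    side.\<close>
  have deg: "(n - m + 1) * (n + m + 1) * q (n + 1) m - (2 * n + 1) * z * q n m + q (n - 1) m = 0" for n m
    using L[of n m] by algebra
  have G: "Gamma (s + 1) = s * Gamma s" if "s \<notin> \<int>\<^sub>\<le>\<^sub>0" for s :: complex
    using Gamma_plus1[of s] that by (metis nonpos_Ints_of_int zero_in_nonpos_Ints)
  show "second_kind_recurrence 0 1 0 (- 1) (order_rec \<sigma> w z F) \<nu> \<mu>"
  proof (rule second_kind_recurrenceI)
    fix n m assume D: "second_kind_defined (n + 0) (m + 1)" "second_kind_defined n m" "second_kind_defined (n + 0) (m + - 1)"
    have g: "Gamma (n + m + 1) = (n + m) * Gamma (n + m)"
      "Gamma (n + m + 1 + 1) = (n + m + 1) * ((n + m) * Gamma (n + m))"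
      using D G[of "n + m"] G[of "n + m + 1"] by (simp_all add: second_kind_defined_def)
    have "F n (m + 1) = (n + m + 1) * ((n + m) * Gamma (n + m)) * q n (m + 1)"
      "F n m = (n + m) * Gamma (n + m) * q n m" "F n (m - 1) = Gamma (n + m) * q n (m - 1)"
      using F[of n "m + 1"] F[of n m] F[of n "m - 1"] D g by (simp_all add: add.assoc[symmetric])
    then show "order_rec \<sigma> w z F n m = 0"
      unfolding order_rec_def using L[of n m] by algebra
  qed
  show "second_kind_recurrence 1 0 (- 1) 0 (degree_rec z F) \<nu> \<mu>"
  proof (rule second_kind_recurrenceI)
    fix n m assume D: "second_kind_defined (n + 1) (m + 0)" "second_kind_defined n m" "second_kind_defined (n + - 1) (m + 0)"
    have s: "n + 1 + m = n + m + 1" by simp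
    have g: "Gamma (n + m + 1) = (n + m) * Gamma (n + m)"
      "Gamma (n + m + 1 + 1) = (n + m + 1) * ((n + m) * Gamma (n + m))"
      using D G[of "n + m"] G[of "n + m + 1"] by (simp_all add: second_kind_defined_def)
    have "F (n + 1) m = (n + m + 1) * ((n + m) * Gamma (n + m)) * q (n + 1) m"
      "F n m = (n + m) * Gamma (n + m) * q n m" "F (n - 1) m = Gamma (n + m) * q (n - 1) m"
      using F[of "n + 1" m] F[of n m] F[of "n - 1" m] D g by (simp_all add: s)
    then show "degree_rec z F n m = 0"
      unfolding degree_rec_def using deg[of n m] by algebra
  qed
  have 1: "second_kind_recurrence 1 1 (- 1) (- 1) (diagonal_rec 1 \<sigma> w z F) \<nu> \<mu>"
  proof (rule second_kind_recurrenceI)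
    fix n m assume D: "second_kind_defined (n + 1) (m + 1)" "second_kind_defined n m" "second_kind_defined (n + - 1) (m + - 1)"
    define t where "t = n + m"
    define g where "g = Gamma (t - 1)"
    have D': "t + 3 \<notin> \<int>\<^sub>\<le>\<^sub>0" "t + 1 \<notin> \<int>\<^sub>\<le>\<^sub>0" "t - 1 \<notin> \<int>\<^sub>\<le>\<^sub>0"
      using D by (simp_all add: second_kind_defined_def t_def algebra_simps)
    \<comment> \<open>The three functions carry \<open>Gamma\<close> at t - 1, t + 1 and t + 3. The
      functional equation also passes through t and t + 2, which are safe because their predecessors
      are not non-positive integers.\<close>
    have "t \<notin> \<int>\<^sub>\<le>\<^sub>0" "t + 2 \<notin> \<int>\<^sub>\<le>\<^sub>0"
      using D'(2,3) nonpos_Ints_diff_Nats[of t 1] nonpos_Ints_diff_Nats[of "t + 2" 1] by (auto simp: add.commute)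
    then have G3: "Gamma (t + 1) = t * ((t - 1) * g)"
      "Gamma (t + 3) = (t + 2) * ((t + 1) * (t * ((t - 1) * g)))"
      using D' G[of "t - 1"] G[of t] G[of "t + 1"] G[of "t + 2"] by (simp_all add: g_def add.commute[of _ t])
    have e: "n + 1 + (m + 1) + 1 = t + 3" "n + m + 1 = t + 1" "n + - 1 + (m + - 1) + 1 = t - 1"
      by (simp_all add: t_def)
    have F3: "F (n + 1) (m + 1) = (t + 2) * ((t + 1) * (t * ((t - 1) * g))) * q (n + 1) (m + 1)"
      "F n m = t * ((t - 1) * g) * q n m" "F (n - 1) (m - 1) = g * q (n - 1) (m - 1)"
      using D[THEN F] unfolding e G3 g_def[symmetric] by simp_all
    have "(t + 2) * w * q (n + 1) (m + 1) = (n + 1 - m) * z * q (n + 1) m - q n m"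
      "\<sigma> * w * q (n - 1) (m - 1) = z * q (n - 1) m - t * q n m"
      using L(2)[of "n + 1" m] L(3)[of "n - 1" m] by (simp_all add: t_def algebra_simps)
    then have "(t + 2) * (t + 1) * w * q (n + 1) (m + 1) + ((2 * n + 1) * (1 - z\<^sup>2) + 2 * m) * q n m
        + \<sigma> * w * q (n - 1) (m - 1) = 0"
      using deg[of n m] unfolding t_def by algebra
    then have "w * F (n + 1) (m + 1) + ((2 * n + 1) * (1 - z\<^sup>2) + 2 * m) * F n m
        + \<sigma> * (t * (t - 1) * w * F (n - 1) (m - 1)) = 0"
      unfolding F3 by algebra
    then show "diagonal_rec 1 \<sigma> w z F n m = 0"
      by (simp add: diagonal_rec_def t_def algebra_simps)
  qed
  have 2: "second_kind_recurrence (- 1) 1 1 (- 1) (diagonal_rec (- 1) \<sigma> w z F) \<nu> \<mu>"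
  proof (rule second_kind_recurrenceI)
    fix n m assume D: "second_kind_defined (n + - 1) (m + 1)" "second_kind_defined n m" "second_kind_defined (n + 1) (m + - 1)"
    \<comment> \<open>For this sign the sum of degree and order is the same in all three functions,
      so they share a single \<open>Gamma\<close> factor.\<close>
    have F3: "F (n - 1) (m + 1) = Gamma (n + m + 1) * q (n - 1) (m + 1)"
      "F n m = Gamma (n + m + 1) * q n m" "F (n + 1) (m - 1) = Gamma (n + m + 1) * q (n + 1) (m - 1)"
      using F[of "n - 1" "m + 1"] F[of n m] F[of "n + 1" "m - 1"] D by simp_all
    have "w * q (n - 1) (m + 1) = (n - m) * q n m - z * q (n - 1) m"
      "\<sigma> * (n - m + 2) * w * q (n + 1) (m - 1) = q n m - (n + m + 1) * z * q (n + 1) m"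
      using L(1)[of "n - 1" m] L(4)[of "n + 1" m] by (simp_all add: algebra_simps)
    then have "w * q (n - 1) (m + 1) + (- (2 * n + 1) * (1 - z\<^sup>2) + 2 * m) * q n m
        + \<sigma> * ((n - m + 1) * (n - m + 2) * w * q (n + 1) (m - 1)) = 0"
      using deg[of n m] by algebra
    then have "w * F (n - 1) (m + 1) + (- (2 * n + 1) * (1 - z\<^sup>2) + 2 * m) * F n m
        + \<sigma> * ((n - m + 1) * (n - m + 2) * w * F (n + 1) (m - 1)) = 0"
      unfolding F3 by algebra
    then show "diagonal_rec (- 1) \<sigma> w z F n m = 0"
      by (simp add: diagonal_rec_def algebra_simps)
  qed
  show "second_kind_recurrence s 1 (- s) (- 1) (diagonal_rec s \<sigma> w z F) \<nu> \<mu>" if "s \<in> {1, - 1}"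
    using that 1 2 by auto
qed

lemma ladder_imp_reg_ladder:
  assumes "ladder \<sigma> w z F"
  shows "reg_ladder \<sigma> w z (\<lambda>\<nu> \<mu>. rGamma (\<nu> + \<mu> + 1) * F \<nu> \<mu>)"
  unfolding reg_ladder_def
proof (intro allI)
  fix \<nu> \<mu> :: complex
  note L = ladderD[OF assms, of \<nu> \<mu>]
  have r: "rGamma (\<nu> + \<mu>) = (\<nu> + \<mu>) * rGamma (\<nu> + \<mu> + 1)"
    "rGamma (\<nu> + \<mu> + 1) = (\<nu> + \<mu> + 1) * rGamma (\<nu> + \<mu> + 1 + 1)"
    using rGamma_plus1[of "\<nu> + \<mu>"] rGamma_plus1[of "\<nu> + \<mu> + 1"] by simp_all
  have e: "\<nu> + (\<mu> + 1) + 1 = \<nu> + \<mu> + 1 + 1" "\<nu> + 1 + \<mu> + 1 = \<nu> + \<mu> + 1 + 1"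
    "\<nu> - 1 + \<mu> + 1 = \<nu> + \<mu>" "\<nu> + (\<mu> - 1) + 1 = \<nu> + \<mu>"
    by simp_all
  show "w * (rGamma (\<nu> + (\<mu> + 1) + 1) * F \<nu> (\<mu> + 1)) =
          (\<nu> - \<mu> + 1) * (rGamma (\<nu> + 1 + \<mu> + 1) * F (\<nu> + 1) \<mu>) - z * (rGamma (\<nu> + \<mu> + 1) * F \<nu> \<mu>) \<and>
        (\<nu> + \<mu> + 1) * w * (rGamma (\<nu> + (\<mu> + 1) + 1) * F \<nu> (\<mu> + 1)) =
          (\<nu> - \<mu>) * z * (rGamma (\<nu> + \<mu> + 1) * F \<nu> \<mu>) - rGamma (\<nu> - 1 + \<mu> + 1) * F (\<nu> - 1) \<mu> \<and>
        \<sigma> * w * (rGamma (\<nu> + (\<mu> - 1) + 1) * F \<nu> (\<mu> - 1)) =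
          z * (rGamma (\<nu> + \<mu> + 1) * F \<nu> \<mu>) - (\<nu> + \<mu> + 1) * (rGamma (\<nu> + 1 + \<mu> + 1) * F (\<nu> + 1) \<mu>) \<and>
        \<sigma> * (\<nu> - \<mu> + 1) * w * (rGamma (\<nu> + (\<mu> - 1) + 1) * F \<nu> (\<mu> - 1)) =
          rGamma (\<nu> - 1 + \<mu> + 1) * F (\<nu> - 1) \<mu> - (\<nu> + \<mu>) * z * (rGamma (\<nu> + \<mu> + 1) * F \<nu> \<mu>)"
    unfolding e using r L by (intro conjI) algebra+
qed

text \<open>Under \<mu> \<mapsto> - \<mu> the lowering rungs of \<open>F\<close> become raising
  rungs and conversely. The factor \<open>rGamma (\<nu> - \<mu> + 1)\<close> restores their
  coefficients, and the exchange costs the sign of \<open>w\<close>. This is the ladder for the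
  second summand in the formula for Q.\<close>

lemma ladder_imp_reg_ladder_reflect:
  assumes "ladder 1 w z F"
  shows "reg_ladder 1 (- w) z (\<lambda>\<nu> \<mu>. rGamma (\<nu> - \<mu> + 1) * F \<nu> (- \<mu>))"
  unfolding reg_ladder_def
proof (intro allI)
  fix \<nu> \<mu> :: complex
  have m: "- (\<mu> + 1) = - \<mu> - 1" "- (\<mu> - 1) = - \<mu> + 1" by simp_all
  note L = ladderD[OF assms, of \<nu> "- \<mu>"]
  have r: "rGamma (\<nu> - \<mu>) = (\<nu> - \<mu>) * rGamma (\<nu> - \<mu> + 1)"
    "rGamma (\<nu> - \<mu> + 1) = (\<nu> - \<mu> + 1) * rGamma (\<nu> - \<mu> + 1 + 1)"
    using rGamma_plus1[of "\<nu> - \<mu>"] rGamma_plus1[of "\<nu> - \<mu> + 1"] by simp_all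
  have e: "\<nu> - (\<mu> + 1) + 1 = \<nu> - \<mu>" "\<nu> + 1 - \<mu> + 1 = \<nu> - \<mu> + 1 + 1"
    "\<nu> - 1 - \<mu> + 1 = \<nu> - \<mu>" "\<nu> - (\<mu> - 1) + 1 = \<nu> - \<mu> + 1 + 1"
    by simp_all
  show "- w * (rGamma (\<nu> - (\<mu> + 1) + 1) * F \<nu> (- (\<mu> + 1))) =
          (\<nu> - \<mu> + 1) * (rGamma (\<nu> + 1 - \<mu> + 1) * F (\<nu> + 1) (- \<mu>)) - z * (rGamma (\<nu> - \<mu> + 1) * F \<nu> (- \<mu>)) \<and>
        (\<nu> + \<mu> + 1) * - w * (rGamma (\<nu> - (\<mu> + 1) + 1) * F \<nu> (- (\<mu> + 1))) =
          (\<nu> - \<mu>) * z * (rGamma (\<nu> - \<mu> + 1) * F \<nu> (- \<mu>)) - rGamma (\<nu> - 1 - \<mu> + 1) * F (\<nu> - 1) (- \<mu>) \<and>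
        1 * - w * (rGamma (\<nu> - (\<mu> - 1) + 1) * F \<nu> (- (\<mu> - 1))) =
          z * (rGamma (\<nu> - \<mu> + 1) * F \<nu> (- \<mu>)) - (\<nu> + \<mu> + 1) * (rGamma (\<nu> + 1 - \<mu> + 1) * F (\<nu> + 1) (- \<mu>)) \<and>
        1 * (\<nu> - \<mu> + 1) * - w * (rGamma (\<nu> - (\<mu> - 1) + 1) * F \<nu> (- (\<mu> - 1))) =
          rGamma (\<nu> - 1 - \<mu> + 1) * F (\<nu> - 1) (- \<mu>) - (\<nu> + \<mu>) * z * (rGamma (\<nu> - \<mu> + 1) * F \<nu> (- \<mu>))"
    unfolding e m using r L by (intro conjI) algebra+
qed

text \<open>For fixed degree each rung combines shifted values of \<open>g\<close> with coefficients
  continuous in \<mu>, so it survives a limit in the order. The values of \<open>g\<close> need not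
  equal the limits.\<close>

lemma reg_ladder_limit:
  assumes "reg_ladder \<sigma> w z g" and lim: "\<And>\<nu> \<mu>. (g \<nu> \<longlongrightarrow> q \<nu> \<mu>) (at \<mu>)"
  shows "reg_ladder \<sigma> w z q"
  unfolding reg_ladder_def
proof (intro allI)
  fix \<nu> \<mu>
  note L = reg_ladderD[OF assms(1)]
  have up: "((\<lambda>m. g \<nu> (m + 1)) \<longlongrightarrow> q \<nu> (\<mu> + 1)) (at \<mu>)"
    using LIM_offset[OF lim[of \<nu> "\<mu> + 1"], of 1] by simp
  have down: "((\<lambda>m. g \<nu> (m - 1)) \<longlongrightarrow> q \<nu> (\<mu> - 1)) (at \<mu>)"
    using LIM_offset[OF lim[of \<nu> "\<mu> - 1"], of "- 1"] by simp
  have eq: "a = b" if "(f \<longlongrightarrow> a) (at \<mu>)" "(h \<longlongrightarrow> b) (at \<mu>)" "\<And>m. f m = h m" for f h and a b :: complex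
    using tendsto_unique[OF _ that(1), of b] that(2,3) by (simp add: ext[of f h])
  show "w * q \<nu> (\<mu> + 1) = (\<nu> - \<mu> + 1) * q (\<nu> + 1) \<mu> - z * q \<nu> \<mu> \<and>
     (\<nu> + \<mu> + 1) * w * q \<nu> (\<mu> + 1) = (\<nu> - \<mu>) * z * q \<nu> \<mu> - q (\<nu> - 1) \<mu> \<and>
     \<sigma> * w * q \<nu> (\<mu> - 1) = z * q \<nu> \<mu> - (\<nu> + \<mu> + 1) * q (\<nu> + 1) \<mu> \<and>
     \<sigma> * (\<nu> - \<mu> + 1) * w * q \<nu> (\<mu> - 1) = q (\<nu> - 1) \<mu> - (\<nu> + \<mu>) * z * q \<nu> \<mu>"
  proof (intro conjI)
    show "w * q \<nu> (\<mu> + 1) = (\<nu> - \<mu> + 1) * q (\<nu> + 1) \<mu> - z * q \<nu> \<mu>"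
      by (rule eq[of "\<lambda>m. w * g \<nu> (m + 1)" _ "\<lambda>m. (\<nu> - m + 1) * g (\<nu> + 1) m - z * g \<nu> m"])
        (rule tendsto_intros up down lim | rule L(1))+
    show "(\<nu> + \<mu> + 1) * w * q \<nu> (\<mu> + 1) = (\<nu> - \<mu>) * z * q \<nu> \<mu> - q (\<nu> - 1) \<mu>"
      by (rule eq[of "\<lambda>m. (\<nu> + m + 1) * w * g \<nu> (m + 1)" _ "\<lambda>m. (\<nu> - m) * z * g \<nu> m - g (\<nu> - 1) m"])
        (rule tendsto_intros up down lim | rule L(2))+
    show "\<sigma> * w * q \<nu> (\<mu> - 1) = z * q \<nu> \<mu> - (\<nu> + \<mu> + 1) * q (\<nu> + 1) \<mu>"
      by (rule eq[of "\<lambda>m. \<sigma> * w * g \<nu> (m - 1)" _ "\<lambda>m. z * g \<nu> m - (\<nu> + m + 1) * g (\<nu> + 1) m"])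
        (rule tendsto_intros up down lim | rule L(3))+
    show "\<sigma> * (\<nu> - \<mu> + 1) * w * q \<nu> (\<mu> - 1) = q (\<nu> - 1) \<mu> - (\<nu> + \<mu>) * z * q \<nu> \<mu>"
      by (rule eq[of "\<lambda>m. \<sigma> * (\<nu> - m + 1) * w * g \<nu> (m - 1)" _ "\<lambda>m. g (\<nu> - 1) m - (\<nu> + m) * z * g \<nu> m"])
        (rule tendsto_intros up down lim | rule L(4))+
  qed
qed

section \<open>Functions of the first kind\<close>

lemma complex_of_real_powr_half: "0 \<le> r \<Longrightarrow> complex_of_real r powr (1 / 2) = of_real (sqrt r)"
  using powr_of_real[of r "1 / 2"] by (simp add: powr_half_sqrt)

text \<open>The relations obtained from \<open>up\<close> and \<open>down\<close> by the symmetry \<open>\<nu> \<mapsto> -\<nu> - 1\<close> are the other two rungs.\<close>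

lemma ladder_prefactor:
  assumes sym: "\<And>\<nu> \<mu>. \<Phi> (- \<nu> - 1) \<mu> = \<Phi> \<nu> \<mu>"
    and up: "\<And>\<nu> \<mu>. 2 * (1 - x) * \<Phi> \<nu> (\<mu> + 1) =
      (\<nu> - \<mu> + 1) * \<Phi> (\<nu> + 1) \<mu> - (\<nu> + \<mu> + 1) * (1 - 2 * x) * \<Phi> \<nu> \<mu>"
    and down: "\<And>\<nu> \<mu>. 2 * (\<nu> + \<mu>) * x * \<Phi> \<nu> (\<mu> - 1) = (1 - 2 * x) * \<Phi> \<nu> \<mu> - \<Phi> (\<nu> + 1) \<mu>"
    and r: "0 < r" "w * of_real (sqrt r) = 2 * (1 - x)" "\<sigma> * w = 2 * x * of_real (sqrt r)" "z = 1 - 2 * x"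
  shows "ladder \<sigma> w z (\<lambda>\<nu> \<mu>. of_real r powr (\<mu> / 2) * \<Phi> \<nu> \<mu>)"
  unfolding ladder_def
proof (intro allI)
  fix \<nu> \<mu> :: complex
  define E where "E = complex_of_real r powr (\<mu> / 2)"
  \<comment> \<open>A unit step of the order changes the prefactor by \<open>sqrt r\<close>. The
    assumptions on \<open>w\<close> turn this into the factors 2 (1 - x) and 2 x that stand in
    \<open>up\<close> and \<open>down\<close>.\<close>
  have "complex_of_real r powr ((\<mu> + 1) / 2) = E * of_real (sqrt r)"
    using r(1) by (simp add: E_def add_divide_distrib powr_add complex_of_real_powr_half)
  then have E_up: "w * complex_of_real r powr ((\<mu> + 1) / 2) = 2 * (1 - x) * E"
    using r(2) by algebra
  have "complex_of_real r powr ((\<mu> - 1) / 2) = E / of_real (sqrt r)"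
    using r(1) by (simp add: E_def diff_divide_distrib powr_diff complex_of_real_powr_half)
  then have E_down: "\<sigma> * w * complex_of_real r powr ((\<mu> - 1) / 2) = 2 * x * E"
    using r(1,3) by simp
  have up': "2 * (1 - x) * \<Phi> \<nu> (\<mu> + 1) = (\<nu> - \<mu>) * (1 - 2 * x) * \<Phi> \<nu> \<mu> - (\<nu> + \<mu>) * \<Phi> (\<nu> - 1) \<mu>"
    using up[of "- \<nu> - 1" \<mu>] sym[of \<nu> "\<mu> + 1"] sym[of \<nu> \<mu>] sym[of "\<nu> - 1" \<mu>] by (simp add: algebra_simps)
  have down': "2 * (\<nu> - \<mu> + 1) * x * \<Phi> \<nu> (\<mu> - 1) = \<Phi> (\<nu> - 1) \<mu> - (1 - 2 * x) * \<Phi> \<nu> \<mu>"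
    using down[of "- \<nu> - 1" \<mu>] sym[of \<nu> "\<mu> - 1"] sym[of \<nu> \<mu>] sym[of "\<nu> - 1" \<mu>] by (simp add: algebra_simps)
  show "w * (of_real r powr ((\<mu> + 1) / 2) * \<Phi> \<nu> (\<mu> + 1)) =
          (\<nu> - \<mu> + 1) * (of_real r powr (\<mu> / 2) * \<Phi> (\<nu> + 1) \<mu>) -
          (\<nu> + \<mu> + 1) * z * (of_real r powr (\<mu> / 2) * \<Phi> \<nu> \<mu>) \<and>
        w * (of_real r powr ((\<mu> + 1) / 2) * \<Phi> \<nu> (\<mu> + 1)) =
          (\<nu> - \<mu>) * z * (of_real r powr (\<mu> / 2) * \<Phi> \<nu> \<mu>) -
          (\<nu> + \<mu>) * (of_real r powr (\<mu> / 2) * \<Phi> (\<nu> - 1) \<mu>) \<and>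
        \<sigma> * (\<nu> + \<mu>) * w * (of_real r powr ((\<mu> - 1) / 2) * \<Phi> \<nu> (\<mu> - 1)) =
          z * (of_real r powr (\<mu> / 2) * \<Phi> \<nu> \<mu>) - of_real r powr (\<mu> / 2) * \<Phi> (\<nu> + 1) \<mu> \<and>
        \<sigma> * (\<nu> - \<mu> + 1) * w * (of_real r powr ((\<mu> - 1) / 2) * \<Phi> \<nu> (\<mu> - 1)) =
          of_real r powr (\<mu> / 2) * \<Phi> (\<nu> - 1) \<mu> - z * (of_real r powr (\<mu> / 2) * \<Phi> \<nu> \<mu>)"
    using E_up E_down up[of \<nu> \<mu>] down[of \<nu> \<mu>] up' down' r(4) unfolding E_def[symmetric]
    by (intro conjI) algebra+
qed

text \<open>Any set of integers is closed, also after removal of the limit point. Hence the raw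
  formulas hold on a punctured neighbourhood of every exceptional parameter.\<close>

lemma eventually_notin_subset_Ints:
  fixes a k :: complex
  assumes "A \<subseteq> \<int>"
  shows "\<forall>\<^sub>F t in at a. t + k \<notin> A"
proof -
  have "closed (A - {a + k})"
    using assms by (intro closed_subset_Ints) auto
  then have "\<forall>\<^sub>F t in at (a + k). t \<notin> A"
    unfolding eventually_at_topological by (intro exI[of _ "- (A - {a + k})"] conjI open_Compl) auto
  then have "\<forall>\<^sub>F t in filtermap (\<lambda>x. x - - k) (at a). t \<notin> A"
    unfolding filtermap_at_shift by simp
  then show ?thesis
    by (simp add: eventually_filtermap)
qed

text \<open>The conditional is the common shape of the four function definitions; a limit
  \<open>l\<close> of a function agreeing with the raw formula near the point settles both
  branches.\<close>

lemma if_Lim_eqI: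
  fixes f g :: "complex \<Rightarrow> complex"
  assumes "(f \<longlongrightarrow> l) (at a)" "\<forall>\<^sub>F t in at a. g t = f t" "\<not> P \<Longrightarrow> g a = l"
  shows "(if P then Lim (at a) g else g a) = l"
proof -
  have "(g \<longlongrightarrow> l) (at a)"
    using assms(1) tendsto_cong[OF assms(2)] by simp
  then show ?thesis
    using assms(3) by (auto intro: tendsto_Lim)
qed

lemma holomorphic_UNIV_tendsto:
  fixes f :: "complex \<Rightarrow> complex"
  assumes "f holomorphic_on UNIV"
  shows "(f \<longlongrightarrow> f a) (at a)"
  using holomorphic_on_imp_continuous_on[OF assms]
  by (simp add: continuous_on_eq_continuous_at isCont_def)

lemma eventually_order_nonexceptional:
  "\<forall>\<^sub>F m in at \<mu>. 1 - m \<notin> \<int>\<^sub>\<le>\<^sub>0" for \<mu> :: complex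
proof -
  have "{m. 1 - m \<in> \<int>\<^sub>\<le>\<^sub>0} \<subseteq> (\<int> :: complex set)"
  proof
    fix m :: complex assume "m \<in> {m. 1 - m \<in> \<int>\<^sub>\<le>\<^sub>0}"
    then have "1 - (1 - m) \<in> \<int>"
      by (intro Ints_diff) (use nonpos_Ints_subset_Ints in auto)
    then show "m \<in> \<int>" by simp
  qed
  from eventually_notin_subset_Ints[OF this, where k = 0] show ?thesis by simp
qed

text \<open>With a = 1 + z and b equal to 1 - z or z - 1, these are the two conditions linking
  \<open>w\<close> to the prefactor in \<open>ladder_prefactor\<close>.\<close>

lemma sqrt_mult_sqrt_divide:
  fixes a b :: real
  assumes "0 < a" "0 < b"
  shows "sqrt (a * b) * sqrt (a / b) = a" and "sqrt (a * b) = b * sqrt (a / b)"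
proof -
  have "sqrt (a * b) * sqrt (a / b) = sqrt (a * a)" "b * sqrt (a / b) = sqrt (b * b) * sqrt (a / b)"
    using assms by (simp_all flip: real_sqrt_mult)
  then show "sqrt (a * b) * sqrt (a / b) = a" "sqrt (a * b) = b * sqrt (a / b)"
    using assms by (simp_all only: real_sqrt_mult [symmetric]) (simp_all add: mult.commute)
qed

section \<open>Ferrers functions of the first kind\<close>

definition ferrers_P_entire :: "complex \<Rightarrow> real \<Rightarrow> complex \<Rightarrow> complex" where
  "ferrers_P_entire \<nu> z \<mu> =
     of_real ((1 + z) / (1 - z)) powr (\<mu> / 2) * reg_hyp (- \<nu>) (\<nu> + 1) (1 - \<mu>) (of_real ((1 - z) / 2))"

lemma holomorphic_ferrers_P_entire:
  assumes "- 1 < z" "z < 1"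
  shows "ferrers_P_entire \<nu> z holomorphic_on UNIV"
  unfolding ferrers_P_entire_def[abs_def]
  using assms by (intro holomorphic_intros holomorphic_reg_hyp_param) (auto simp: norm_divide simp flip: of_real_diff)

lemma ferrers_P_eq:
  assumes "- 1 < z" "z < 1"
  shows "ferrers_P \<nu> \<mu> z = ferrers_P_entire \<nu> z \<mu>"
proof -
  have raw: "ferrers_P_raw \<nu> m z = ferrers_P_entire \<nu> z m" if "1 - m \<notin> \<int>\<^sub>\<le>\<^sub>0" for m
  proof -
    have "norm (complex_of_real ((1 - z) / 2)) < 1"
      unfolding norm_of_real using assms by simp
    then show ?thesis
      using that by (simp add: ferrers_P_raw_def ferrers_P_entire_def gauss_2F1_eq_reg_hyp Gamma_eq_zero_iff
          del: of_real_divide of_real_diff of_real_add)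
  qed
  show ?thesis
    unfolding ferrers_P_def
  proof (rule if_Lim_eqI)
    show "(ferrers_P_entire \<nu> z \<longlongrightarrow> ferrers_P_entire \<nu> z \<mu>) (at \<mu>)"
      by (rule holomorphic_UNIV_tendsto[OF holomorphic_ferrers_P_entire[OF assms]])
    show "\<forall>\<^sub>F m in at \<mu>. ferrers_P_raw \<nu> m z = ferrers_P_entire \<nu> z m"
      using eventually_order_nonexceptional by eventually_elim (rule raw)
  qed (rule raw)
qed

lemma ladder_ferrers_P:
  assumes "- 1 < z" "z < 1"
  shows "ladder 1 (of_real (sqrt (1 - z\<^sup>2))) (of_real z) (\<lambda>\<nu> \<mu>. ferrers_P \<nu> \<mu> z)"
proof -
  let ?x = "complex_of_real ((1 - z) / 2)"
  let ?\<Phi> = "\<lambda>\<nu> \<mu>. reg_hyp (- \<nu>) (\<nu> + 1) (1 - \<mu>)"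
  have zero: "0 \<in> ball (0::complex) 1" by simp
  have x: "?x \<in> ball 0 1"
    unfolding mem_ball_0 norm_of_real using assms by simp
  note hyp = legendre_ladder[where \<Phi> = ?\<Phi> and U = "ball 0 1" and x = ?x,
      OF has_fps_expansion_reg_hyp holomorphic_reg_hyp open_ball connected_ball zero x]
  have "1 - z\<^sup>2 = (1 + z) * (1 - z)"
    by (simp add: power2_eq_square algebra_simps)
  then have "sqrt (1 - z\<^sup>2) * sqrt ((1 + z) / (1 - z)) = 1 + z" "sqrt (1 - z\<^sup>2) = (1 - z) * sqrt ((1 + z) / (1 - z))"
    using sqrt_mult_sqrt_divide[of "1 + z" "1 - z"] assms by simp_all
  then have w: "complex_of_real (sqrt (1 - z\<^sup>2)) * of_real (sqrt ((1 + z) / (1 - z))) = of_real (1 + z)"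
    "complex_of_real (sqrt (1 - z\<^sup>2)) = of_real (1 - z) * of_real (sqrt ((1 + z) / (1 - z)))"
    by (simp_all only: of_real_mult [symmetric])
  have "ladder 1 (of_real (sqrt (1 - z\<^sup>2))) (of_real z)
      (\<lambda>\<nu> \<mu>. of_real ((1 + z) / (1 - z)) powr (\<mu> / 2) * ?\<Phi> \<nu> \<mu> ?x)"
  proof (rule ladder_prefactor[where \<Phi> = "\<lambda>\<nu> \<mu>. ?\<Phi> \<nu> \<mu> ?x" and x = ?x, OF hyp])
    show "0 < (1 + z) / (1 - z)" using assms by simp
    show "complex_of_real (sqrt (1 - z\<^sup>2)) * of_real (sqrt ((1 + z) / (1 - z))) = 2 * (1 - ?x)"
      unfolding w(1) by (simp add: field_simps)
    show "1 * complex_of_real (sqrt (1 - z\<^sup>2)) = 2 * ?x * of_real (sqrt ((1 + z) / (1 - z)))"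
      unfolding w(2) by simp
    show "of_real z = 1 - 2 * ?x"
      by (simp add: field_simps)
  qed
  then show ?thesis
    by (simp only: ferrers_P_eq[OF assms] ferrers_P_entire_def)
qed

section \<open>Legendre functions of the first kind for z > 1\<close>

definition legendre_P_entire :: "complex \<Rightarrow> real \<Rightarrow> complex \<Rightarrow> complex" where
  "legendre_P_entire \<nu> z \<mu> =
     of_real ((1 + z) / (z - 1)) powr (\<mu> / 2) * reg_hyp_pfaff (- \<nu>) (\<nu> + 1) (1 - \<mu>) (of_real ((1 - z) / 2))"

lemma holomorphic_legendre_P_entire:
  assumes "1 < z"
  shows "legendre_P_entire \<nu> z holomorphic_on UNIV"
  unfolding legendre_P_entire_def[abs_def] reg_hyp_pfaff_def
  by (intro holomorphic_intros holomorphic_reg_hyp_param norm_pfaff_lt_1) (use assms in \<open>simp_all only: Re_complex_of_real, simp\<close>)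

lemma legendre_P_eq:
  assumes "1 < z"
  shows "legendre_P \<nu> \<mu> z = legendre_P_entire \<nu> z \<mu>"
proof -
  have raw: "legendre_P_raw \<nu> m z = legendre_P_entire \<nu> z m" if "1 - m \<notin> \<int>\<^sub>\<le>\<^sub>0" for m
  proof -
    have "Re (complex_of_real ((1 - z) / 2)) < 1 / 2"
      unfolding Re_complex_of_real using assms by simp
    then show ?thesis
      using that by (simp add: legendre_P_raw_def legendre_P_entire_def gauss_2F1_eq_reg_hyp_pfaff Gamma_eq_zero_iff
          del: of_real_divide of_real_diff of_real_add Re_complex_of_real less_divide_eq_numeral1)
  qed
  show ?thesis
    unfolding legendre_P_def
  proof (rule if_Lim_eqI)
    show "(legendre_P_entire \<nu> z \<longlongrightarrow> legendre_P_entire \<nu> z \<mu>) (at \<mu>)"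
      by (rule holomorphic_UNIV_tendsto[OF holomorphic_legendre_P_entire[OF assms]])
    show "\<forall>\<^sub>F m in at \<mu>. legendre_P_raw \<nu> m z = legendre_P_entire \<nu> z m"
      using eventually_order_nonexceptional by eventually_elim (rule raw)
  qed (rule raw)
qed

lemma ladder_legendre_P:
  assumes "1 < z"
  shows "ladder (- 1) (of_real (sqrt (z\<^sup>2 - 1))) (of_real z) (\<lambda>\<nu> \<mu>. legendre_P \<nu> \<mu> z)"
proof -
  let ?x = "complex_of_real ((1 - z) / 2)"
  let ?\<Phi> = "\<lambda>\<nu> \<mu>. reg_hyp_pfaff (- \<nu>) (\<nu> + 1) (1 - \<mu>)"
  let ?U = "{x. Re x < 1 / 2}"
  have x: "?x \<in> ?U"
    unfolding mem_Collect_eq Re_complex_of_real using assms by simp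
  have U: "open ?U" "connected ?U" "0 \<in> ?U"
    by (rule open_halfspace_Re_lt, rule convex_connected[OF convex_halfspace_Re_lt], simp)
  note hyp = legendre_ladder[where \<Phi> = ?\<Phi> and U = ?U and x = ?x,
      OF has_fps_expansion_reg_hyp_pfaff holomorphic_reg_hyp_pfaff U x]
  have "z\<^sup>2 - 1 = (1 + z) * (z - 1)"
    by (simp add: power2_eq_square algebra_simps)
  then have "sqrt (z\<^sup>2 - 1) * sqrt ((1 + z) / (z - 1)) = 1 + z" "sqrt (z\<^sup>2 - 1) = (z - 1) * sqrt ((1 + z) / (z - 1))"
    using sqrt_mult_sqrt_divide[of "1 + z" "z - 1"] assms by simp_all
  then have w: "complex_of_real (sqrt (z\<^sup>2 - 1)) * of_real (sqrt ((1 + z) / (z - 1))) = of_real (1 + z)"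
    "complex_of_real (sqrt (z\<^sup>2 - 1)) = of_real (z - 1) * of_real (sqrt ((1 + z) / (z - 1)))"
    by (simp_all only: of_real_mult [symmetric])
  have "ladder (- 1) (of_real (sqrt (z\<^sup>2 - 1))) (of_real z)
      (\<lambda>\<nu> \<mu>. of_real ((1 + z) / (z - 1)) powr (\<mu> / 2) * ?\<Phi> \<nu> \<mu> ?x)"
  proof (rule ladder_prefactor[where \<Phi> = "\<lambda>\<nu> \<mu>. ?\<Phi> \<nu> \<mu> ?x" and x = ?x, OF hyp])
    show "0 < (1 + z) / (z - 1)" using assms by simp
    show "complex_of_real (sqrt (z\<^sup>2 - 1)) * of_real (sqrt ((1 + z) / (z - 1))) = 2 * (1 - ?x)"
      unfolding w(1) by (simp add: field_simps)
    show "- 1 * complex_of_real (sqrt (z\<^sup>2 - 1)) = 2 * ?x * of_real (sqrt ((1 + z) / (z - 1)))"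
      unfolding w(2) by (simp add: algebra_simps)
    show "of_real z = 1 - 2 * ?x"
      by (simp add: field_simps)
  qed
  then show ?thesis
    by (simp only: legendre_P_eq[OF assms] legendre_P_entire_def)
qed

section \<open>Functions of the second kind\<close>

lemma sin_add_pi: "sin ((\<mu> + 1) * of_real pi) = - sin (\<mu> * of_real pi)"
  and cos_add_pi: "cos ((\<mu> + 1) * of_real pi) = - cos (\<mu> * of_real pi)"
  for \<mu> :: complex
  by (simp_all add: distrib_right sin_add cos_add sin_of_real cos_of_real)

lemma sin_diff_pi: "sin ((\<mu> - 1) * of_real pi) = - sin (\<mu> * of_real pi)"
  and cos_diff_pi: "cos ((\<mu> - 1) * of_real pi) = - cos (\<mu> * of_real pi)"
  for \<mu> :: complex
  using sin_add_pi[of "\<mu> - 1"] cos_add_pi[of "\<mu> - 1"] by simp_all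

lemma sin_times_pi_eq_0: "sin (\<mu> * of_real pi) = 0 \<longleftrightarrow> \<mu> \<in> \<int>" for \<mu> :: complex
proof -
  have "sin (\<mu> * of_real pi) = 0 \<longleftrightarrow> (\<exists>n::int. \<mu> * of_real pi = of_int n * of_real pi)"
    by (simp add: sin_eq_0)
  also have "\<dots> \<longleftrightarrow> \<mu> \<in> \<int>"
    by (auto simp: Ints_def)
  finally show ?thesis .
qed

text \<open>The sign of \<open>w\<close> in the ladder of \<open>v\<close> is absorbed by \<open>sin (\<mu>\<pi>)\<close>. At integer \<open>\<mu>\<close> the combination is
  \<open>0\<close> (division by zero), and the relations still hold.\<close>

lemma reg_ladder_cos_sin_combination:
  assumes u: "reg_ladder \<sigma> w z u" and v: "reg_ladder \<sigma> (- w) z v"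
  shows "reg_ladder \<sigma> w z (\<lambda>\<nu> \<mu>. k * (cos (\<mu> * of_real pi) * u \<nu> \<mu> - v \<nu> \<mu>) / sin (\<mu> * of_real pi))"
  unfolding reg_ladder_def sin_add_pi cos_add_pi sin_diff_pi cos_diff_pi divide_inverse inverse_minus_eq
proof (intro allI conjI)
  fix \<nu> \<mu> :: complex
  let ?c = "cos (\<mu> * of_real pi)" and ?s = "inverse (sin (\<mu> * of_real pi))"
  note uv = reg_ladderD[OF u, of \<nu> \<mu>] reg_ladderD[OF v, of \<nu> \<mu>]
  show "w * (k * (- ?c * u \<nu> (\<mu> + 1) - v \<nu> (\<mu> + 1)) * - ?s) =
      (\<nu> - \<mu> + 1) * (k * (?c * u (\<nu> + 1) \<mu> - v (\<nu> + 1) \<mu>) * ?s) - z * (k * (?c * u \<nu> \<mu> - v \<nu> \<mu>) * ?s)"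
    using uv(1,5) by algebra
  show "(\<nu> + \<mu> + 1) * w * (k * (- ?c * u \<nu> (\<mu> + 1) - v \<nu> (\<mu> + 1)) * - ?s) =
      (\<nu> - \<mu>) * z * (k * (?c * u \<nu> \<mu> - v \<nu> \<mu>) * ?s) - k * (?c * u (\<nu> - 1) \<mu> - v (\<nu> - 1) \<mu>) * ?s"
    using uv(2,6) by algebra
  show "\<sigma> * w * (k * (- ?c * u \<nu> (\<mu> - 1) - v \<nu> (\<mu> - 1)) * - ?s) =
      z * (k * (?c * u \<nu> \<mu> - v \<nu> \<mu>) * ?s) - (\<nu> + \<mu> + 1) * (k * (?c * u (\<nu> + 1) \<mu> - v (\<nu> + 1) \<mu>) * ?s)"
    using uv(3,7) by algebra
  show "\<sigma> * (\<nu> - \<mu> + 1) * w * (k * (- ?c * u \<nu> (\<mu> - 1) - v \<nu> (\<mu> - 1)) * - ?s) =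
      k * (?c * u (\<nu> - 1) \<mu> - v (\<nu> - 1) \<mu>) * ?s - (\<nu> + \<mu>) * z * (k * (?c * u \<nu> \<mu> - v \<nu> \<mu>) * ?s)"
    using uv(4,8) by algebra
qed

text \<open>The classical proportionality of the functions of orders n and - n, without division by
  Gamma values. The two sides agree at order 0, and since w \<noteq> 0 the first rung determines
  order n + 1 from order n. That rung uses degree \<nu> + 1, so the induction runs over all degrees
  at once.\<close>

lemma reflected_order_eq:
  fixes F :: "complex \<Rightarrow> complex \<Rightarrow> complex"
  assumes F: "ladder 1 w z F" and w: "w \<noteq> 0"
    and \<mu>: "\<mu> \<in> \<int>"
  shows "cos (\<mu> * of_real pi) * (rGamma (\<nu> + \<mu> + 1) * F \<nu> \<mu>) = rGamma (\<nu> - \<mu> + 1) * F \<nu> (- \<mu>)"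
proof -
  let ?u = "\<lambda>\<nu> \<mu>. rGamma (\<nu> + \<mu> + 1) * F \<nu> \<mu>" and ?v = "\<lambda>\<nu> \<mu>. rGamma (\<nu> - \<mu> + 1) * F \<nu> (- \<mu>)"
  have nat: "cos (of_nat n * of_real pi) * ?u \<nu> (of_nat n) = ?v \<nu> (of_nat n)" for n \<nu>
  proof (induction n arbitrary: \<nu>)
    case 0
    then show ?case by simp
  next
    case (Suc n)
    let ?m = "of_nat n :: complex"
    have "w * (- cos (?m * of_real pi) * ?u \<nu> (?m + 1)) = w * ?v \<nu> (?m + 1)"
      using reg_ladderD(1)[OF ladder_imp_reg_ladder[OF F], of \<nu> ?m]
        reg_ladderD(1)[OF ladder_imp_reg_ladder_reflect[OF F], of \<nu> ?m] Suc.IH[of \<nu>] Suc.IH[of "\<nu> + 1"]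
      by algebra
    then have "cos ((?m + 1) * of_real pi) * ?u \<nu> (?m + 1) = ?v \<nu> (?m + 1)"
      using w unfolding cos_add_pi mult_cancel_left by blast
    then show ?case by (simp add: add.commute)
  qed
  obtain k where k: "\<mu> = of_int k" using \<mu> by (rule Ints_cases)
  show ?thesis
  proof (cases "k \<ge> 0")
    case True
    then show ?thesis using nat[of "nat k" \<nu>] by (simp add: k)
  next
    case False
    define n where "n = nat (- k)"
    have n: "\<mu> = - of_nat n" using False by (simp add: n_def k)
    \<comment> \<open>For order - n the functions \<open>?u\<close> and \<open>?v\<close> trade
      places, and the square of cos (n \<pi>) is 1.\<close>
    have "cos (of_nat n * complex_of_real pi) * ?v \<nu> (of_nat n) = ?u \<nu> (of_nat n)"
      unfolding nat[of n \<nu>, symmetric] by (simp flip: power_mult_distrib mult.assoc)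
    then show ?thesis by (simp add: n)
  qed
qed

section \<open>Ferrers functions of the second kind\<close>

definition ferrers_Q_gen :: "complex \<Rightarrow> real \<Rightarrow> complex \<Rightarrow> complex" where
  "ferrers_Q_gen \<nu> z \<mu> = of_real pi / 2 *
     (cos (\<mu> * of_real pi) * (rGamma (\<nu> + \<mu> + 1) * ferrers_P \<nu> \<mu> z) - rGamma (\<nu> - \<mu> + 1) * ferrers_P \<nu> (- \<mu>) z) /
     sin (\<mu> * of_real pi)"

text \<open>At an integer order the numerator vanishes and the zero of the sine is simple, because
  sine and cosine have no common zero; so L'Hopital's rule applies. The point is that the limit
  exists, for only then does \<open>Lim\<close> have the intended meaning.\<close>

lemma tendsto_ferrers_Q_gen:
  assumes z: "- 1 < z" "z < 1"
  shows "(ferrers_Q_gen \<nu> z \<longlongrightarrow> Lim (at \<mu>) (ferrers_Q_gen \<nu> z)) (at \<mu>)"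
    and "\<mu> \<notin> \<int> \<Longrightarrow> Lim (at \<mu>) (ferrers_Q_gen \<nu> z) = ferrers_Q_gen \<nu> z \<mu>"
proof -
  define N where "N = (\<lambda>m. of_real pi / 2 * (cos (m * of_real pi) * (rGamma (\<nu> + m + 1) * ferrers_P \<nu> m z) -
      rGamma (\<nu> - m + 1) * ferrers_P \<nu> (- m) z))"
  have gen: "ferrers_Q_gen \<nu> z = (\<lambda>m. N m / sin (m * of_real pi))"
    by (simp add: ferrers_Q_gen_def[abs_def] N_def)
  have "(\<lambda>m. ferrers_P_entire \<nu> z (- m)) holomorphic_on UNIV"
    using holomorphic_on_compose_gen[OF _ holomorphic_ferrers_P_entire[OF z], of uminus UNIV \<nu>]
    by (simp add: o_def holomorphic_on_minus)
  then have hol: "N holomorphic_on UNIV"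
    unfolding N_def ferrers_P_eq[OF z] using holomorphic_ferrers_P_entire[OF z, of \<nu>]
    by (intro holomorphic_intros)
  have cont: "(ferrers_Q_gen \<nu> z \<longlongrightarrow> ferrers_Q_gen \<nu> z \<mu>) (at \<mu>)" if "\<mu> \<notin> \<int>"
  proof -
    have "sin (\<mu> * of_real pi) \<noteq> 0"
      using that sin_times_pi_eq_0[of \<mu>] by blast
    then show ?thesis
      unfolding gen by (intro tendsto_intros holomorphic_UNIV_tendsto[OF hol])
  qed
  have "\<exists>l. (ferrers_Q_gen \<nu> z \<longlongrightarrow> l) (at \<mu>)"
  proof (cases "\<mu> \<in> \<int>")
    case True
    have "z\<^sup>2 < 1"
      using z abs_square_less_1[of z] by (simp add: abs_if)
    then have "complex_of_real (sqrt (1 - z\<^sup>2)) \<noteq> 0" by simp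
    from reflected_order_eq[OF ladder_ferrers_P[OF z] this True, of \<nu>]
    have N: "N \<mu> = 0" by (simp add: N_def)
    have s: "sin (\<mu> * of_real pi) = 0"
      using True by (simp add: sin_times_pi_eq_0)
    have dN: "(N has_field_derivative deriv N \<mu>) (at \<mu>)"
      using hol by (intro holomorphic_derivI[of _ UNIV]) auto
    have ds: "((\<lambda>m. sin (m * of_real pi)) has_field_derivative cos (\<mu> * of_real pi) * of_real pi) (at \<mu>)"
      by (auto intro!: derivative_eq_intros)
    have "cos (\<mu> * of_real pi) * of_real pi \<noteq> 0"
      using s sin_cos_squared_add[of "\<mu> * of_real pi"] by auto
    from lhopital_complex_simple[OF dN ds N s this refl] show ?thesis
      unfolding gen by (rule exI)
  next
    case False
    then show ?thesis using cont by (intro exI)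
  qed
  then obtain l where l: "(ferrers_Q_gen \<nu> z \<longlongrightarrow> l) (at \<mu>)" ..
  then show "(ferrers_Q_gen \<nu> z \<longlongrightarrow> Lim (at \<mu>) (ferrers_Q_gen \<nu> z)) (at \<mu>)"
    unfolding tendsto_Lim[OF trivial_limit_at l] .
  show "Lim (at \<mu>) (ferrers_Q_gen \<nu> z) = ferrers_Q_gen \<nu> z \<mu>" if "\<mu> \<notin> \<int>"
    using tendsto_Lim[OF trivial_limit_at cont[OF that]] .
qed

lemma reg_ladder_ferrers_Q:
  assumes z: "- 1 < z" "z < 1"
  shows "reg_ladder 1 (of_real (sqrt (1 - z\<^sup>2))) (of_real z) (\<lambda>\<nu> \<mu>. Lim (at \<mu>) (ferrers_Q_gen \<nu> z))"
proof (rule reg_ladder_limit)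
  note P = ladder_ferrers_P[OF z]
  show "reg_ladder 1 (of_real (sqrt (1 - z\<^sup>2))) (of_real z) (\<lambda>\<nu>. ferrers_Q_gen \<nu> z)"
    unfolding ferrers_Q_gen_def[abs_def]
    by (rule reg_ladder_cos_sin_combination[OF ladder_imp_reg_ladder[OF P] ladder_imp_reg_ladder_reflect[OF P]])
qed (rule tendsto_ferrers_Q_gen[OF z])

lemma ferrers_Q_eq:
  assumes z: "- 1 < z" "z < 1" and D: "second_kind_defined \<nu> \<mu>"
  shows "ferrers_Q \<nu> \<mu> z = Gamma (\<nu> + \<mu> + 1) * Lim (at \<mu>) (ferrers_Q_gen \<nu> z)"
  unfolding ferrers_Q_def
proof (rule if_Lim_eqI)
  have D': "\<nu> + \<mu> + 1 \<notin> \<int>\<^sub>\<le>\<^sub>0" using D by (simp add: second_kind_defined_def)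
  have raw: "ferrers_Q_raw \<nu> m z = Gamma (\<nu> + m + 1) * ferrers_Q_gen \<nu> z m" if "\<nu> + m + 1 \<notin> \<int>\<^sub>\<le>\<^sub>0" for m
  proof -
    \<comment> \<open>Here h is \<open>Gamma (\<nu> - m + 1)\<close>. At a pole h = 0, so g / h and
      the inverse of h are both 0, in accordance with the value of \<open>rGamma\<close>.\<close>
    have "a / 2 * (c / s * p - 1 / s * (g / h) * q) = g * (a / 2 * (c * (inverse g * p) - inverse h * q) / s)"
      if "g \<noteq> 0" for a c s p g h q :: complex
      using that by (cases "s = 0"; cases "h = 0") (simp_all add: field_simps)
    moreover have "Gamma (\<nu> + m + 1) \<noteq> 0" using that by (simp add: Gamma_eq_zero_iff)
    ultimately show ?thesis
      unfolding ferrers_Q_raw_def ferrers_Q_gen_def cot_def rGamma_inverse_Gamma by blast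
  qed
  show "((\<lambda>m. Gamma (\<nu> + m + 1) * ferrers_Q_gen \<nu> z m) \<longlongrightarrow>
      Gamma (\<nu> + \<mu> + 1) * Lim (at \<mu>) (ferrers_Q_gen \<nu> z)) (at \<mu>)"
    by (intro tendsto_intros tendsto_ferrers_Q_gen z D')
  have "\<forall>\<^sub>F m in at \<mu>. m + (\<nu> + 1) \<notin> \<int>\<^sub>\<le>\<^sub>0"
    by (rule eventually_notin_subset_Ints[OF nonpos_Ints_subset_Ints])
  then show "\<forall>\<^sub>F m in at \<mu>. ferrers_Q_raw \<nu> m z = Gamma (\<nu> + m + 1) * ferrers_Q_gen \<nu> z m"
    by eventually_elim (simp add: raw add.assoc add.left_commute)
  show "ferrers_Q_raw \<nu> \<mu> z = Gamma (\<nu> + \<mu> + 1) * Lim (at \<mu>) (ferrers_Q_gen \<nu> z)" if "\<mu> \<notin> \<int>"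
    unfolding tendsto_ferrers_Q_gen(2)[OF z that] by (rule raw[OF D'])
qed

section \<open>Legendre functions of the second kind for z > 1\<close>

definition legendre_Q_entire :: "real \<Rightarrow> complex \<Rightarrow> complex \<Rightarrow> complex" where
  "legendre_Q_entire z \<nu> \<mu> = exp (\<mu> * of_real pi * \<i>) * (of_real (sqrt pi) / 2 powr (\<nu> + 1)) *
     (of_real (z\<^sup>2 - 1) powr (\<mu> / 2) / of_real z powr (\<nu> + \<mu> + 1)) * second_hyp \<nu> \<mu> (of_real (1 / z\<^sup>2))"

text \<open>Holomorphy in the degree, with the order fixed, since here the exceptional values are
  limits in \<nu>.\<close>

lemma holomorphic_legendre_Q_entire:
  assumes "1 < z"
  shows "(\<lambda>\<nu>. legendre_Q_entire z \<nu> \<mu>) holomorphic_on UNIV"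
proof -
  have "norm (complex_of_real (1 / z\<^sup>2)) < 1"
    unfolding norm_of_real using assms by (simp add: power_less_one_iff one_less_power)
  then show ?thesis
    unfolding legendre_Q_entire_def using assms
    by (intro holomorphic_intros holomorphic_reg_hyp_param) auto
qed

lemma legendre_Q_eq:
  assumes z: "1 < z" and D: "second_kind_defined \<nu> \<mu>"
  shows "legendre_Q \<nu> \<mu> z = Gamma (\<nu> + \<mu> + 1) * legendre_Q_entire z \<nu> \<mu>"
  unfolding legendre_Q_def
proof (rule if_Lim_eqI)
  have D': "\<nu> + \<mu> + 1 \<notin> \<int>\<^sub>\<le>\<^sub>0" using D by (simp add: second_kind_defined_def)
  have y: "norm (complex_of_real (1 / z\<^sup>2)) < 1"
    unfolding norm_of_real using z by (simp add: power_less_one_iff one_less_power)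
  have raw: "legendre_Q_raw n \<mu> z = Gamma (n + \<mu> + 1) * legendre_Q_entire z n \<mu>" if "n + 3 / 2 \<notin> \<int>\<^sub>\<le>\<^sub>0" for n
  proof -
    have "Gamma (n + 3 / 2) \<noteq> 0" using that by (simp add: Gamma_eq_zero_iff)
    then show ?thesis
      unfolding legendre_Q_raw_def legendre_Q_entire_def gauss_2F1_eq_reg_hyp[OF that y] by simp
  qed
  show "((\<lambda>n. Gamma (n + \<mu> + 1) * legendre_Q_entire z n \<mu>) \<longlongrightarrow>
      Gamma (\<nu> + \<mu> + 1) * legendre_Q_entire z \<nu> \<mu>) (at \<nu>)"
    by (intro tendsto_intros holomorphic_UNIV_tendsto holomorphic_legendre_Q_entire z D')
  have "\<forall>\<^sub>F n in at \<nu>. n + 3 / 2 \<notin> \<int>\<^sub>\<le>\<^sub>0"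
    by (rule eventually_notin_subset_Ints[OF nonpos_Ints_subset_Ints])
  then show "\<forall>\<^sub>F n in at \<nu>. legendre_Q_raw n \<mu> z = Gamma (n + \<mu> + 1) * legendre_Q_entire z n \<mu>"
    by eventually_elim (rule raw)
  show "legendre_Q_raw \<nu> \<mu> z = Gamma (\<nu> + \<mu> + 1) * legendre_Q_entire z \<nu> \<mu>" if "\<not> \<nu> + 3 / 2 \<in> \<int>\<^sub>\<le>\<^sub>0"
    using that by (rule raw)
qed

text \<open>A step of \<mu> multiplies the prefactor by - w / z and a step of \<nu> by 1 / (2 z),
  which turns the ladder in y = 1 / z^2 into the one in z. The minus sign comes from the factor
  e^(\<mu>\<pi>i): it gives the unnormalized Q the same signs as P.\<close>

lemma reg_ladder_legendre_Q:
  assumes z: "1 < z"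
  shows "reg_ladder (- 1) (of_real (sqrt (z\<^sup>2 - 1))) (of_real z) (legendre_Q_entire z)"
  unfolding reg_ladder_def
proof (intro allI)
  fix \<nu> \<mu>
  define y where "y = complex_of_real (1 / z\<^sup>2)"
  define Z where "Z = complex_of_real z"
  define w where "w = complex_of_real (sqrt (z\<^sup>2 - 1))"
  define E where "E = (\<lambda>n m. exp (m * of_real pi * \<i>) * (of_real (sqrt pi) / 2 powr (n + 1)) *
     (of_real (z\<^sup>2 - 1) powr (m / 2) / Z powr (n + m + 1)))"
  have Q: "legendre_Q_entire z n m = E n m * second_hyp n m y" for n m
    by (simp add: legendre_Q_entire_def E_def y_def Z_def)
  have y: "norm y < 1"
    unfolding y_def norm_of_real using z by (simp add: power_less_one_iff one_less_power)
  have Z0: "Z \<noteq> 0" and yZ: "y * Z * Z = 1"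
    using z by (simp_all add: Z_def y_def power2_eq_square)
  have z2: "0 < z\<^sup>2 - 1"
    using z by (simp add: one_less_power)
  then have w0: "w \<noteq> 0" by (simp add: w_def)
  have w2: "w * w = Z * Z - 1"
    using z2 by (simp add: w_def Z_def power2_eq_square flip: of_real_mult)
  have half: "complex_of_real (z\<^sup>2 - 1) powr (1 / 2) = w"
    using z2 complex_of_real_powr_half[of "z\<^sup>2 - 1"] by (simp add: w_def)
  have powr: "complex_of_real (z\<^sup>2 - 1) powr ((m + 1) / 2) = complex_of_real (z\<^sup>2 - 1) powr (m / 2) * w" for m
    unfolding half[symmetric] by (simp only: add_divide_distrib powr_add)
  have E_order: "E n (m + 1) * Z = - w * E n m" for n m
  proof -
    have "exp ((m + 1) * of_real pi * \<i>) = - exp (m * of_real pi * \<i>)"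
      by (simp add: distrib_right exp_add)
    moreover have "Z powr (n + (m + 1) + 1) = Z powr (n + m + 1) * Z"
      using Z0 powr_add[of Z "n + m + 1" 1] by (simp add: add_ac)
    ultimately show ?thesis
      unfolding E_def powr using Z0 by simp
  qed
  have E_degree: "2 * Z * E (n + 1) m = E n m" for n m
  proof -
    have "Z powr (n + 1 + m + 1) = Z powr (n + m + 1) * Z" "2 powr (n + 1 + 1) = 2 powr (n + 1) * (2::complex)"
      using Z0 powr_add[of Z "n + m + 1" 1] powr_add[of "2::complex" "n + 1" 1] by (simp_all add: add_ac)
    then show ?thesis
      unfolding E_def using Z0 by simp
  qed
  have E: "E \<nu> (\<mu> + 1) * Z = - w * E \<nu> \<mu>" "w * E \<nu> (\<mu> - 1) = - Z * E \<nu> \<mu>"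
    "2 * Z * E (\<nu> + 1) \<mu> = E \<nu> \<mu>" "E (\<nu> - 1) \<mu> = 2 * Z * E \<nu> \<mu>"
    using E_order[of \<nu> \<mu>] E_order[of \<nu> "\<mu> - 1"] E_degree[of \<nu> \<mu>] E_degree[of "\<nu> - 1" \<mu>]
    by (simp_all add: mult.commute)
  note H = second_hyp_ladder[OF y, of \<nu> \<mu>]
  \<comment> \<open>Since y Z^2 = 1, quotients by Z can be written as products with y. This produces
    exactly the factors 1 - y and y of the rungs in \<open>H\<close>.\<close>
  have E': "w * E \<nu> (\<mu> + 1) = - Z * (1 - y) * E \<nu> \<mu>" "E (\<nu> + 1) \<mu> = y * Z / 2 * E \<nu> \<mu>"
  proof -
    have "Z * (w * E \<nu> (\<mu> + 1)) = Z * (- Z * (1 - y) * E \<nu> \<mu>)"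
      using E(1) w2 yZ by algebra
    then show "w * E \<nu> (\<mu> + 1) = - Z * (1 - y) * E \<nu> \<mu>" by (simp only: mult_left_cancel[OF Z0])
    have "Z * E (\<nu> + 1) \<mu> = Z * (y * Z / 2 * E \<nu> \<mu>)"
      using E(3) yZ by (simp add: field_simps)
    then show "E (\<nu> + 1) \<mu> = y * Z / 2 * E \<nu> \<mu>" using Z0 by simp
  qed
  show "of_real (sqrt (z\<^sup>2 - 1)) * legendre_Q_entire z \<nu> (\<mu> + 1) =
          (\<nu> - \<mu> + 1) * legendre_Q_entire z (\<nu> + 1) \<mu> - of_real z * legendre_Q_entire z \<nu> \<mu> \<and>
        (\<nu> + \<mu> + 1) * of_real (sqrt (z\<^sup>2 - 1)) * legendre_Q_entire z \<nu> (\<mu> + 1) =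
          (\<nu> - \<mu>) * of_real z * legendre_Q_entire z \<nu> \<mu> - legendre_Q_entire z (\<nu> - 1) \<mu> \<and>
        - 1 * of_real (sqrt (z\<^sup>2 - 1)) * legendre_Q_entire z \<nu> (\<mu> - 1) =
          of_real z * legendre_Q_entire z \<nu> \<mu> - (\<nu> + \<mu> + 1) * legendre_Q_entire z (\<nu> + 1) \<mu> \<and>
        - 1 * (\<nu> - \<mu> + 1) * of_real (sqrt (z\<^sup>2 - 1)) * legendre_Q_entire z \<nu> (\<mu> - 1) =
          legendre_Q_entire z (\<nu> - 1) \<mu> - (\<nu> + \<mu>) * of_real z * legendre_Q_entire z \<nu> \<mu>"
    unfolding Q w_def[symmetric] Z_def[symmetric]
  proof (intro conjI)
    show "w * (E \<nu> (\<mu> + 1) * second_hyp \<nu> (\<mu> + 1) y) =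
        (\<nu> - \<mu> + 1) * (E (\<nu> + 1) \<mu> * second_hyp (\<nu> + 1) \<mu> y) - Z * (E \<nu> \<mu> * second_hyp \<nu> \<mu> y)"
      using E' H(1) by algebra
    show "(\<nu> + \<mu> + 1) * w * (E \<nu> (\<mu> + 1) * second_hyp \<nu> (\<mu> + 1) y) =
        (\<nu> - \<mu>) * Z * (E \<nu> \<mu> * second_hyp \<nu> \<mu> y) - E (\<nu> - 1) \<mu> * second_hyp (\<nu> - 1) \<mu> y"
      using E'(1) E(4) H(2) by algebra
    show "- 1 * w * (E \<nu> (\<mu> - 1) * second_hyp \<nu> (\<mu> - 1) y) =
        Z * (E \<nu> \<mu> * second_hyp \<nu> \<mu> y) - (\<nu> + \<mu> + 1) * (E (\<nu> + 1) \<mu> * second_hyp (\<nu> + 1) \<mu> y)"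
      using E'(2) E(2) H(3) by algebra
    show "- 1 * (\<nu> - \<mu> + 1) * w * (E \<nu> (\<mu> - 1) * second_hyp \<nu> (\<mu> - 1) y) =
        E (\<nu> - 1) \<mu> * second_hyp (\<nu> - 1) \<mu> y - (\<nu> + \<mu>) * Z * (E \<nu> \<mu> * second_hyp \<nu> \<mu> y)"
      using E(2,4) H(4) by algebra
  qed
qed

section \<open>The stated left-hand sides as instances of the uniform recurrences\<close>

lemma
  fixes F :: "complex \<Rightarrow> complex \<Rightarrow> real \<Rightarrow> complex"
  shows ferrers_order_lhs_eq: "(\<lambda>\<nu> \<mu>. ferrers_order_lhs F \<nu> \<mu> z) =
      order_rec 1 (of_real (sqrt (1 - z\<^sup>2))) (of_real z) (\<lambda>\<nu> \<mu>. F \<nu> \<mu> z)"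
    and degree_lhs_eq: "(\<lambda>\<nu> \<mu>. degree_lhs F \<nu> \<mu> z) = degree_rec (of_real z) (\<lambda>\<nu> \<mu>. F \<nu> \<mu> z)"
    and ferrers_diagonal_lhs_eq: "(\<lambda>\<nu> \<mu>. ferrers_diagonal_lhs s F \<nu> \<mu> z) =
      diagonal_rec s 1 (of_real (sqrt (1 - z\<^sup>2))) (of_real z) (\<lambda>\<nu> \<mu>. F \<nu> \<mu> z)"
    and legendre_order_lhs_eq: "(\<lambda>\<nu> \<mu>. legendre_order_lhs F \<nu> \<mu> z) =
      order_rec (- 1) (of_real (sqrt (z\<^sup>2 - 1))) (of_real z) (\<lambda>\<nu> \<mu>. F \<nu> \<mu> z)"
    and legendre_diagonal_lhs_eq: "(\<lambda>\<nu> \<mu>. legendre_diagonal_lhs s F \<nu> \<mu> z) =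
      diagonal_rec s (- 1) (of_real (sqrt (z\<^sup>2 - 1))) (of_real z) (\<lambda>\<nu> \<mu>. F \<nu> \<mu> z)"
proof -
  have "- s * (2 * \<nu> + 1) * of_real (z\<^sup>2 - 1) = s * (2 * \<nu> + 1) * (1 - (of_real z)\<^sup>2)" for \<nu>
    by (simp add: algebra_simps)
  then show "(\<lambda>\<nu> \<mu>. legendre_diagonal_lhs s F \<nu> \<mu> z) =
      diagonal_rec s (- 1) (of_real (sqrt (z\<^sup>2 - 1))) (of_real z) (\<lambda>\<nu> \<mu>. F \<nu> \<mu> z)"
    unfolding legendre_diagonal_lhs_def diagonal_rec_def fun_eq_iff by simp
qed (simp_all add: fun_eq_iff ferrers_order_lhs_def order_rec_def degree_lhs_def degree_rec_def
    ferrers_diagonal_lhs_def diagonal_rec_def legendre_order_lhs_def)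

theorem theorem9p2:
  fixes \<nu> \<mu> :: complex and z :: real
  shows
    "(- 1 < z \<and> z < 1 \<longrightarrow>
        ferrers_order_lhs ferrers_P \<nu> \<mu> z = 0 \<and>
        degree_lhs ferrers_P \<nu> \<mu> z = 0 \<and>
        (\<forall>s\<in>{1, - 1}. ferrers_diagonal_lhs s ferrers_P \<nu> \<mu> z = 0) \<and>
        second_kind_recurrence 0 1 0 (- 1) (\<lambda>n m. ferrers_order_lhs ferrers_Q n m z) \<nu> \<mu> \<and>
        second_kind_recurrence 1 0 (- 1) 0 (\<lambda>n m. degree_lhs ferrers_Q n m z) \<nu> \<mu> \<and>
        (\<forall>s\<in>{1, - 1}. second_kind_recurrence s 1 (- s) (- 1)
           (\<lambda>n m. ferrers_diagonal_lhs s ferrers_Q n m z) \<nu> \<mu>)) \<and>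
     (1 < z \<longrightarrow>
        legendre_order_lhs legendre_P \<nu> \<mu> z = 0 \<and>
        degree_lhs legendre_P \<nu> \<mu> z = 0 \<and>
        (\<forall>s\<in>{1, - 1}. legendre_diagonal_lhs s legendre_P \<nu> \<mu> z = 0) \<and>
        second_kind_recurrence 0 1 0 (- 1) (\<lambda>n m. legendre_order_lhs legendre_Q n m z) \<nu> \<mu> \<and>
        second_kind_recurrence 1 0 (- 1) 0 (\<lambda>n m. degree_lhs legendre_Q n m z) \<nu> \<mu> \<and>
        (\<forall>s\<in>{1, - 1}. second_kind_recurrence s 1 (- s) (- 1)
           (\<lambda>n m. legendre_diagonal_lhs s legendre_Q n m z) \<nu> \<mu>))"
proof (intro conjI impI)
  note lhs_eqs = ferrers_order_lhs_eq degree_lhs_eq ferrers_diagonal_lhs_eq legendre_order_lhs_eq legendre_diagonal_lhs_eq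
  note lhs_apply = lhs_eqs[THEN fun_cong, THEN fun_cong]
  {
    assume "- 1 < z \<and> z < 1"
    then have z: "- 1 < z" "z < 1" by simp_all
    note P = ladder_recurrences[OF ladder_ferrers_P[OF z]]
    note Q = reg_ladder_recurrences[OF reg_ladder_ferrers_Q[OF z] ferrers_Q_eq[OF z]]
    show "ferrers_order_lhs ferrers_P \<nu> \<mu> z = 0" "degree_lhs ferrers_P \<nu> \<mu> z = 0"
      "\<forall>s\<in>{1, - 1}. ferrers_diagonal_lhs s ferrers_P \<nu> \<mu> z = 0"
      unfolding lhs_apply by (blast intro: P)+
    show "second_kind_recurrence 0 1 0 (- 1) (\<lambda>n m. ferrers_order_lhs ferrers_Q n m z) \<nu> \<mu>"
      "second_kind_recurrence 1 0 (- 1) 0 (\<lambda>n m. degree_lhs ferrers_Q n m z) \<nu> \<mu>"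
      "\<forall>s\<in>{1, - 1}. second_kind_recurrence s 1 (- s) (- 1) (\<lambda>n m. ferrers_diagonal_lhs s ferrers_Q n m z) \<nu> \<mu>"
      unfolding lhs_eqs by (blast intro: Q)+
  }
  {
    assume z: "1 < z"
    note P = ladder_recurrences[OF ladder_legendre_P[OF z]]
    note Q = reg_ladder_recurrences[OF reg_ladder_legendre_Q[OF z] legendre_Q_eq[OF z]]
    show "legendre_order_lhs legendre_P \<nu> \<mu> z = 0" "degree_lhs legendre_P \<nu> \<mu> z = 0"
      "\<forall>s\<in>{1, - 1}. legendre_diagonal_lhs s legendre_P \<nu> \<mu> z = 0"
      unfolding lhs_apply by (blast intro: P)+
    show "second_kind_recurrence 0 1 0 (- 1) (\<lambda>n m. legendre_order_lhs legendre_Q n m z) \<nu> \<mu>"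
      "second_kind_recurrence 1 0 (- 1) 0 (\<lambda>n m. degree_lhs legendre_Q n m z) \<nu> \<mu>"
      "\<forall>s\<in>{1, - 1}. second_kind_recurrence s 1 (- s) (- 1) (\<lambda>n m. legendre_diagonal_lhs s legendre_Q n m z) \<nu> \<mu>"
      unfolding lhs_eqs by (blast intro: Q)+
  }
qed

end
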